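(* Let $K$ be an integral domain containing $\mathbb Q$ as a subring, let $t$ be an indeterminate over $K$, and put $K^*=K[t]$. Let $f\in z+z^2K[[z]]$, let $f_*=\operatorname{itlog}(f)\in z^2K[[z]]$ be its iterative logarithm, and let $f^{[t]}\in zK^*[[z]]$ be its $t$-th fractional iterate. Then the following are equivalent: (1) $f_*$ is differentially algebraic over $K[z]$; (2) $f^{[t]}$ is differentially algebraic over $K[z]$; (3) $f^{[t]}$ is differentially algebraic over $K^*$.
   Context: Matrices are indexed by $\mathbb N\times\mathbb N$, $\mathbb N=\{0,1,2,\dots\}$. A reference sequence is a sequence $\Omega=(\Omega_n)_{n\ge0}$ of non-zero rational numbers with $\Omega_0=\Omega_1=1$. For $f\in zK[[z]]$, the iteration matrix $[f]^\Omega$ is the upper triangular matrix determined by $\Omega_if^i=\sum_{j\ge0}[f]^\Omega_{ij}\Omega_jz^j$ for all $i$. For $h=\sum_{n\ge1}h_nz^n\in zK[[z]]$, $\langle h\rangle^\Omega$ is the upper triangular matrix with $\langle h\rangle^\Omega_{ij}=\frac{\Omega_i}{\Omega_j}\,i\,h_{j-i+1}$ for $i\le j$ and $0$ for $i>j$. For a strictly upper triangular matrix $M$, $\exp(M)=\sum_{n\ge0}M^n/n!$ and $\log(1+M)=\sum_{n\ge1}(-1)^{n+1}M^n/n$. Iterative logarithm: for $f\in z+z^2K[[z]]$ there is a unique $h\in z^2K[[z]]$ with $\log[f]^\Omega=\langle h\rangle^\Omega$, and $h$ does not depend on $\Omega$; it is denoted $\operatorname{itlog}(f)=f_*$. (Equivalently,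 $f_*=\sum_{n\ge1}\frac{(-1)^{n-1}}{n}h[n]$ where $h[0]=z$, $h[n+1]=h[n]\circ f-h[n]$.) Fractional iterate: $f^{[t]}=\sum_{j\ge1}\big(\exp(t\langle f_*\rangle^\Omega)\big)_{1j}\,\Omega_jz^j\in z+z^2K^*[[z]]$, which does not depend on $\Omega$. $K[[z]]$ and $K^*[[z]]$ are viewed as differential rings with the derivation $d/dz$ (respectively $\partial/\partial z$, so that $t$ is a constant). An element $y$ of a differential ring extension of a differential ring $R$ is differentially algebraic over $R$ if there is a non-zero polynomial $P$ in the indeterminates $Y,Y',Y'',\dots$ with coefficients in $R$ such that $P(y,y',y'',\dots)=0$. *)

theory Defs
  imports
    "HOL-Computational_Algebra.Computational_Algebra"
    "HOL-Library.Poly_Mapping"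
begin

section \<open>The ground ring\<close>

text \<open>
  An integral domain containing the rationals as a subring is an \<open>idom\<close> together with an
  embedding of \<open>rat\<close>.  (Such an embedding is unique if it exists; \<open>of_rat\<close> is not available,
  since it needs a field.)
\<close>

definition rat_embedding :: "(rat \<Rightarrow> 'a::idom) \<Rightarrow> bool" where
  "rat_embedding \<iota> \<longleftrightarrow>
     inj \<iota> \<and> \<iota> 1 = 1 \<and> (\<forall>p q. \<iota> (p + q) = \<iota> p + \<iota> q) \<and> (\<forall>p q. \<iota> (p * q) = \<iota> p * \<iota> q)"

definition reference_sequence :: "(nat \<Rightarrow> rat) \<Rightarrow> bool" where
  "reference_sequence \<Omega> \<longleftrightarrow> (\<forall>n. \<Omega> n \<noteq> 0) \<and> \<Omega> 0 = 1 \<and> \<Omega> 1 = 1"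


section \<open>Upper triangular matrices indexed by the natural numbers\<close>

type_synonym 'a nmat = "nat \<Rightarrow> nat \<Rightarrow> 'a"

definition strictly_upper :: "'a::zero nmat \<Rightarrow> bool" where
  "strictly_upper M \<longleftrightarrow> (\<forall>i j. j \<le> i \<longrightarrow> M i j = 0)"

definition mat_one :: "'a::zero_neq_one nmat" where
  "mat_one = (\<lambda>i j. if i = j then 1 else 0)"

text \<open>
  The full sum over all \<open>k\<close> is cut off at \<open>k = j\<close>, which is the matrix product as soon as
  the right factor is upper triangular.
\<close>

definition mat_mult :: "'a::comm_ring_1 nmat \<Rightarrow> 'a nmat \<Rightarrow> 'a nmat" where
  "mat_mult A B = (\<lambda>i j. \<Sum>k\<le>j. A i k * B k j)"

primrec mat_pow :: "'a::comm_ring_1 nmat \<Rightarrow> nat \<Rightarrow> 'a nmat" where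
  "mat_pow M 0 = mat_one"
| "mat_pow M (Suc n) = mat_mult M (mat_pow M n)"

lemma mat_pow_eq_0:
  assumes "strictly_upper M" and "j < i + n"
  shows "mat_pow M n i j = 0"
  using assms(2)
proof (induction n arbitrary: i)
  case 0
  then show ?case by (simp add: mat_one_def)
next
  case (Suc n)
  have "M i k * mat_pow M n k j = 0" for k
  proof (cases "k \<le> i")
    case True
    then show ?thesis using assms(1) by (simp add: strictly_upper_def)
  next
    case False
    then have "mat_pow M n k j = 0" using Suc.prems by (intro Suc.IH) simp
    then show ?thesis by simp
  qed
  then show ?case by (simp add: mat_mult_def)
qed

text \<open>
  Exponential and logarithm.  By \<open>mat_pow_eq_0\<close> the terms with \<open>n > j\<close> of the two power
  series vanish at position \<open>(i, j)\<close> if \<open>M\<close>, respectively \<open>A - 1\<close>, is strictly upper triangular.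
\<close>

definition mat_exp :: "(rat \<Rightarrow> 'a::idom) \<Rightarrow> 'a nmat \<Rightarrow> 'a nmat" where
  "mat_exp \<iota> M = (\<lambda>i j. \<Sum>n\<le>j. \<iota> (1 / fact n) * mat_pow M n i j)"

definition mat_log :: "(rat \<Rightarrow> 'a::idom) \<Rightarrow> 'a nmat \<Rightarrow> 'a nmat" where
  "mat_log \<iota> A = (\<lambda>i j. \<Sum>n=1..j. \<iota> ((-1) ^ (n + 1) / of_nat n) *
      mat_pow (\<lambda>i j. A i j - mat_one i j) n i j)"


section \<open>Iteration matrices, iterative logarithm, fractional iterates\<close>

text \<open>The iteration matrix, obtained by solving
  \<open>\<Omega>\<^sub>i f\<^sup>i = (\<Sum>j\<ge>0. [f]\<^sub>i\<^sub>j \<Omega>\<^sub>j z\<^sup>j)\<close> for its entries.\<close>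

definition iter_mat :: "(rat \<Rightarrow> 'a::idom) \<Rightarrow> (nat \<Rightarrow> rat) \<Rightarrow> 'a fps \<Rightarrow> 'a nmat" where
  "iter_mat \<iota> \<Omega> f = (\<lambda>i j. \<iota> (\<Omega> i / \<Omega> j) * fps_nth (f ^ i) j)"

definition inf_iter_mat :: "(rat \<Rightarrow> 'a::idom) \<Rightarrow> (nat \<Rightarrow> rat) \<Rightarrow> 'a fps \<Rightarrow> 'a nmat" where
  "inf_iter_mat \<iota> \<Omega> h =
     (\<lambda>i j. if i \<le> j then \<iota> (\<Omega> i / \<Omega> j) * of_nat i * fps_nth h (j - i + 1) else 0)"

definition itlog :: "(rat \<Rightarrow> 'a::idom) \<Rightarrow> (nat \<Rightarrow> rat) \<Rightarrow> 'a fps \<Rightarrow> 'a fps" where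
  "itlog \<iota> \<Omega> f =
     (THE h. fps_nth h 0 = 0 \<and> fps_nth h 1 = 0 \<and>
        mat_log \<iota> (iter_mat \<iota> \<Omega> f) = inf_iter_mat \<iota> \<Omega> h)"

text \<open>
  The polynomial ring \<open>K[t]\<close> is \<open>'a poly\<close>: the indeterminate \<open>t\<close> is \<open>[:0, 1:]\<close> and the constant
  \<open>c\<close> is \<open>[:c:]\<close>.
\<close>

definition frac_iter :: "(rat \<Rightarrow> 'a::idom) \<Rightarrow> (nat \<Rightarrow> rat) \<Rightarrow> 'a fps \<Rightarrow> 'a poly fps" where
  "frac_iter \<iota> \<Omega> f =
     Abs_fps (\<lambda>j. if j = 0 then 0
       else mat_exp (\<lambda>q. [:\<iota> q:]) (\<lambda>i k. [:0, 1:] * [:inf_iter_mat \<iota> \<Omega> (itlog \<iota> \<Omega> f) i k:]) 1 j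
              * [:\<iota> (\<Omega> j):])"


section \<open>Differential algebraicity\<close>

text \<open>
  The differential polynomials over \<open>'s\<close> in \<open>Y, Y', Y'', \<dots>\<close> are the type
  \<open>(nat \<Rightarrow>\<^sub>0 nat) \<Rightarrow>\<^sub>0 's\<close>: a monomial \<open>m\<close> stands for the product of the
  \<open>(Y\<^bsup>(i)\<^esup>) ^ lookup m i\<close>.  The derivation is \<open>\<delta>\<close>.
\<close>

definition diffpoly_eval ::
    "('s::comm_ring_1 \<Rightarrow> 's) \<Rightarrow> ((nat \<Rightarrow>\<^sub>0 nat) \<Rightarrow>\<^sub>0 's) \<Rightarrow> 's \<Rightarrow> 's" where
  "diffpoly_eval \<delta> P y =
     (\<Sum>m\<in>Poly_Mapping.keys P. Poly_Mapping.lookup P m *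
        (\<Prod>i\<in>Poly_Mapping.keys m. ((\<delta> ^^ i) y) ^ Poly_Mapping.lookup m i))"

text \<open>\<open>R\<close> is meant to be a differential subring of \<open>('s, \<delta>)\<close>.\<close>

definition differentially_algebraic ::
    "('s::comm_ring_1 \<Rightarrow> 's) \<Rightarrow> 's set \<Rightarrow> 's \<Rightarrow> bool" where
  "differentially_algebraic \<delta> R y \<longleftrightarrow>
     (\<exists>P :: (nat \<Rightarrow>\<^sub>0 nat) \<Rightarrow>\<^sub>0 's.
        P \<noteq> 0 \<and> (\<forall>m. Poly_Mapping.lookup P m \<in> R) \<and> diffpoly_eval \<delta> P y = 0)"

text \<open>The subrings \<open>K[z]\<close> of \<open>K[[z]]\<close>, and \<open>K[z]\<close> and \<open>K[t]\<close> of \<open>K[t][[z]]\<close>.\<close>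

definition polys_in_fps :: "'a::idom fps set" where
  "polys_in_fps = range fps_of_poly"

definition polys_in_poly_fps :: "'a::idom poly fps set" where
  "polys_in_poly_fps = range (\<lambda>p. fps_of_poly (map_poly (\<lambda>c. [:c:]) p))"

definition consts_in_poly_fps :: "'a::idom poly fps set" where
  "consts_in_poly_fps = range fps_const"

end

(*
  Work inside S = K[t][[z]] and let h be the iterative logarithm, y = exp (t h d/dz) z the fractional
  iterate. Being differentially algebraic over K, K[z] or K[t] means the same thing: all derivatives
  are algebraic over a finitely generated extension of K, since z and t are themselves differentially
  algebraic over K. Two identities link h and y: dy/dt = h y' and Julia's equation h y' = h o y.
  If y satisfies an algebraic differential equation, apply d/dt to it: by the first identity and
  Leibniz' rule the result is a linear differential equation for h, nontrivial because the separant
  does not vanish. Conversely, if the derivatives of h generate an extension of finite transcendence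
  degree, so do their composites with y; adjoining y itself, Julia's equation shows that the resulting
  algebraic closure is closed under d/dz.
*)

theory Submission
  imports Defs
begin

section \<open>Subrings\<close>

text \<open>Everything stays inside the integral domain S. Spans over a fraction field are expressed
  by clearing denominators, and division becomes the fact that an algebraic closure containing a x
  and a \<noteq> 0 contains x. The common base is K, on which d/dz and d/dt vanish and which
  composition with y fixes. Finite transcendence degree is the form of the property that survives
  the passage from h to h o y: a bound by an arbitrary finite set is carried along by any injective
  homomorphism over K, and the exchange property turns such a bound back into a differential
  equation. Julia's equation is solved for y' by dividing by h, so h = 0, where y = z, is a case of
  its own. Matrices enter only as matrices of operators on K[[z]] in the basis z^k, conjugated by
  the diagonal matrix of \<Omega>: \<open>inf_iter_mat\<close> belongs to h d/dz,
  \<open>iter_mat\<close> to composition with f. As \<open>itlog\<close> is a definite description,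
  the logarithm of the latter must be shown to be of the former kind. The reason is that the
  logarithm of a ring homomorphism is a derivation, which is seen by interpolating the iterates of f
  in t.\<close>

definition is_subring :: "'s::comm_ring_1 set \<Rightarrow> bool" where
  "is_subring A \<longleftrightarrow> 1 \<in> A \<and> (\<forall>a\<in>A. \<forall>b\<in>A. a - b \<in> A \<and> a * b \<in> A)"

lemma
  assumes "is_subring A"
  shows subring_one: "1 \<in> A"
    and subring_diff: "\<And>a b. a \<in> A \<Longrightarrow> b \<in> A \<Longrightarrow> a - b \<in> A"
    and subring_mult: "\<And>a b. a \<in> A \<Longrightarrow> b \<in> A \<Longrightarrow> a * b \<in> A"
  using assms by (auto simp: is_subring_def)

lemma subring_zero: "is_subring A \<Longrightarrow> 0 \<in> A"
  using subring_diff[of A 1 1] subring_one by auto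

lemma subring_uminus: "is_subring A \<Longrightarrow> a \<in> A \<Longrightarrow> - a \<in> A"
  using subring_diff[of A 0 a] subring_zero by auto

lemma subring_add: "is_subring A \<Longrightarrow> a \<in> A \<Longrightarrow> b \<in> A \<Longrightarrow> a + b \<in> A"
  using subring_diff[of A a "- b"] subring_uminus by auto

lemma subring_sum: "is_subring A \<Longrightarrow> (\<And>i. i \<in> I \<Longrightarrow> g i \<in> A) \<Longrightarrow> sum g I \<in> A"
  by (induction I rule: infinite_finite_induct) (auto intro: subring_zero subring_add)

lemma subring_prod: "is_subring A \<Longrightarrow> (\<And>i. i \<in> I \<Longrightarrow> g i \<in> A) \<Longrightarrow> prod g I \<in> A"
  by (induction I rule: infinite_finite_induct) (auto intro: subring_one subring_mult)

lemma subring_power: "is_subring A \<Longrightarrow> a \<in> A \<Longrightarrow> a ^ n \<in> A"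
  by (induction n) (auto intro: subring_one subring_mult)

lemma subring_of_nat: "is_subring A \<Longrightarrow> of_nat n \<in> A"
  by (induction n) (auto intro: subring_one subring_add subring_zero)

lemma subring_poly:
  assumes "is_subring A" "\<And>i. coeff p i \<in> A" "x \<in> A"
  shows "poly p x \<in> A"
  unfolding poly_altdef using assms by (intro subring_sum subring_mult subring_power) auto

lemmas subring_intros = subring_one subring_diff subring_mult subring_zero subring_uminus
  subring_add subring_sum subring_prod subring_power subring_of_nat

inductive_set ring_gen :: "'s::comm_ring_1 set \<Rightarrow> 's set" for G where
  base: "x \<in> G \<Longrightarrow> x \<in> ring_gen G"
| one: "1 \<in> ring_gen G"
| diff: "a \<in> ring_gen G \<Longrightarrow> b \<in> ring_gen G \<Longrightarrow> a - b \<in> ring_gen G"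
| mult: "a \<in> ring_gen G \<Longrightarrow> b \<in> ring_gen G \<Longrightarrow> a * b \<in> ring_gen G"

lemma is_subring_ring_gen: "is_subring (ring_gen G)"
  by (auto simp: is_subring_def intro: ring_gen.intros)

lemma ring_gen_least:
  assumes "is_subring A" "G \<subseteq> A" shows "ring_gen G \<subseteq> A"
proof
  fix x assume "x \<in> ring_gen G"
  then show "x \<in> A" using assms by induction (auto intro: subring_intros)
qed

lemma ring_gen_mono: "G \<subseteq> H \<Longrightarrow> ring_gen G \<subseteq> ring_gen H"
  by (intro ring_gen_least is_subring_ring_gen) (auto intro: ring_gen.base)

lemma ring_gen_subring: "is_subring A \<Longrightarrow> ring_gen A = A"
  using ring_gen_least[of A A] by (auto intro: ring_gen.base)

text \<open>Lets relations over several generators be re-read as polynomials in a chosen one, in the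
  exchange lemma and in the expansion into monomials.\<close>

lemma ring_gen_insert:
  assumes "x \<in> ring_gen (insert y G)"
  obtains p where "\<And>i. coeff p i \<in> ring_gen G" "x = poly p y"
proof -
  note sr = is_subring_ring_gen[of G]
  have "\<exists>p. (\<forall>i. coeff p i \<in> ring_gen G) \<and> x = poly p y"
    using assms
  proof induction
    case (base x)
    show ?case
    proof (cases "x = y")
      case True
      have "coeff [:0, 1:] i \<in> ring_gen G" for i
        using sr by (auto simp: coeff_pCons split: nat.split intro: subring_intros)
      then show ?thesis using True by (intro exI[of _ "[:0, 1:]"]) auto
    next
      case False
      then have "coeff [:x:] i \<in> ring_gen G" for i
        using sr base by (auto simp: coeff_pCons split: nat.split intro: subring_intros ring_gen.base)
      then show ?thesis by (intro exI[of _ "[:x:]"]) auto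
    qed
  next
    case one
    have "coeff 1 i \<in> ring_gen G" for i
      using sr by (auto simp: intro: subring_intros)
    then show ?case by (intro exI[of _ 1]) auto
  next
    case (diff a b)
    then obtain p q where "\<forall>i. coeff p i \<in> ring_gen G" "a = poly p y"
      "\<forall>i. coeff q i \<in> ring_gen G" "b = poly q y" by blast
    then show ?case using sr by (intro exI[of _ "p - q"]) (auto intro: subring_intros)
  next
    case (mult a b)
    then obtain p q where "\<forall>i. coeff p i \<in> ring_gen G" "a = poly p y"
      "\<forall>i. coeff q i \<in> ring_gen G" "b = poly q y" by blast
    then show ?case using sr
      by (intro exI[of _ "p * q"]) (auto simp: coeff_mult intro: subring_intros)
  qed
  with that show thesis by blast
qed

section \<open>Elements algebraic over a subring\<close>

text \<open>Gaussian elimination without division: each equation is cross-multiplied with a pivot,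
  so that all coefficients stay in the subring.\<close>

lemma homogeneous_system_nontrivial_solution:
  fixes c :: "'i \<Rightarrow> 'j \<Rightarrow> 's::idom"
  assumes A: "is_subring A" and "finite I" "finite J" "card I < card J"
    and "\<And>i j. c i j \<in> A"
  shows "\<exists>v. (\<forall>j. v j \<in> A) \<and> (\<exists>j\<in>J. v j \<noteq> 0) \<and> (\<forall>i\<in>I. (\<Sum>j\<in>J. c i j * v j) = 0)"
  using assms(2-)
proof (induction I arbitrary: J c rule: finite_induct)
  case empty
  then have "J \<noteq> {}" by auto
  then show ?case using subring_one[OF A] by (intro exI[of _ "\<lambda>_. 1"]) auto
next
  case (insert i0 I)
  show ?case
  proof (cases "\<forall>j\<in>J. c i0 j = 0")
    case True
    have "card I < card J" using insert by auto
    from insert.IH[OF \<open>finite J\<close> this insert.prems(3)] True show ?thesis by auto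
  next
    case False
    then obtain j0 where j0: "j0 \<in> J" "c i0 j0 \<noteq> 0" by auto
    \<comment> \<open>The 2x2 minors with the pivot eliminate the unknown \<open>j0\<close>; for
      \<open>i = i0\<close> they vanish identically, which takes care of equation
      \<open>i0\<close>.\<close>
    define c' where "c' i j = c i0 j0 * c i j - c i j0 * c i0 j" for i j
    have "c' i j \<in> A" for i j
      unfolding c'_def using A insert.prems(3) by (intro subring_intros)
    moreover have "card I < card (J - {j0})" using insert j0 by auto
    ultimately obtain v where v: "\<And>j. v j \<in> A" "\<exists>j\<in>J - {j0}. v j \<noteq> 0"
      "\<And>i. i \<in> I \<Longrightarrow> (\<Sum>j\<in>J - {j0}. c' i j * v j) = 0"
      using insert.IH[of "J - {j0}" c'] insert.prems(1) by (metis finite_Diff)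
    \<comment> \<open>Back substitution; \<open>v\<close> is scaled by the pivot so that the value
      at \<open>j0\<close> is found without dividing.\<close>
    define v' where "v' j = (if j = j0 then - (\<Sum>j\<in>J - {j0}. c i0 j * v j) else c i0 j0 * v j)" for j
    have *: "(\<Sum>j\<in>J. c i j * v' j) = (\<Sum>j\<in>J - {j0}. c' i j * v j)" for i
    proof -
      have "(\<Sum>j\<in>J. c i j * v' j) = c i j0 * v' j0 + (\<Sum>j\<in>J - {j0}. c i j * v' j)"
        using insert.prems j0 by (simp add: sum.remove)
      also have "(\<Sum>j\<in>J - {j0}. c i j * v' j) = (\<Sum>j\<in>J - {j0}. c i0 j0 * c i j * v j)"
        by (intro sum.cong) (auto simp: v'_def)
      also have "c i j0 * v' j0 = - (\<Sum>j\<in>J - {j0}. c i j0 * c i0 j * v j)"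
        by (simp add: v'_def sum_distrib_left mult.assoc)
      finally show ?thesis by (simp add: c'_def algebra_simps sum_subtractf)
    qed
    have "v' j \<in> A" for j
      unfolding v'_def using A v(1) insert.prems(3) by (auto intro!: subring_intros)
    moreover have "\<exists>j\<in>J. v' j \<noteq> 0" using v(2) j0 by (auto simp: v'_def)
    moreover have "(\<Sum>j\<in>J. c i j * v' j) = 0" if "i \<in> insert i0 I" for i
      using that v(3)[of i] unfolding * by (auto simp: c'_def)
    ultimately show ?thesis by blast
  qed
qed

text \<open>The trace on \<open>'s\<close> of the span of \<open>B\<close> over the fraction field of \<open>A\<close>.\<close>

definition frac_span :: "'s::idom set \<Rightarrow> 's set \<Rightarrow> 's set" where
  "frac_span A B = {s. \<exists>c\<in>A. c \<noteq> 0 \<and> (\<exists>a. (\<forall>b. a b \<in> A) \<and> c * s = (\<Sum>b\<in>B. a b * b))}"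

text \<open>Substitute for a finite extension of the fraction field of A: multipliers map the space
  spanned by B into itself. For finite B they form a ring, and if 1 is in B each of them is
  algebraic over A.\<close>

definition multipliers :: "'s::idom set \<Rightarrow> 's set \<Rightarrow> 's set" where
  "multipliers A B = {s. \<forall>b\<in>B. s * b \<in> frac_span A B}"

lemma frac_spanI:
  "c \<in> A \<Longrightarrow> c \<noteq> 0 \<Longrightarrow> (\<And>b. a b \<in> A) \<Longrightarrow> c * s = (\<Sum>b\<in>B. a b * b) \<Longrightarrow> s \<in> frac_span A B"
  unfolding frac_span_def by blast

lemma frac_span_base:
  assumes "is_subring A" "finite B" "b \<in> B" shows "b \<in> frac_span A B"
proof (rule frac_spanI[where c = 1 and a = "\<lambda>x. if x = b then 1 else 0"])
  show "1 * b = (\<Sum>x\<in>B. (if x = b then 1 else 0) * x)"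
    using assms by (simp add: if_distrib[of "\<lambda>c. c * _"] cong: if_cong)
qed (use assms in \<open>auto intro: subring_intros\<close>)

lemma frac_span_0: "is_subring A \<Longrightarrow> 0 \<in> frac_span A B"
  by (rule frac_spanI[where c = 1 and a = "\<lambda>_. 0"]) (auto intro: subring_intros)

lemma frac_span_add:
  assumes A: "is_subring A" and "s \<in> frac_span A B" "t \<in> frac_span A B"
  shows "s + t \<in> frac_span A B"
proof -
  from assms obtain c a d b where *: "c \<in> A" "c \<noteq> 0" "\<And>x. a x \<in> A" "c * s = (\<Sum>x\<in>B. a x * x)"
    "d \<in> A" "d \<noteq> 0" "\<And>x. b x \<in> A" "d * t = (\<Sum>x\<in>B. b x * x)"
    unfolding frac_span_def by blast
  show ?thesis
  proof (rule frac_spanI[where c = "c * d" and a = "\<lambda>x. d * a x + c * b x"])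
    have "c * d * (s + t) = d * (c * s) + c * (d * t)" by (simp add: algebra_simps)
    also have "\<dots> = (\<Sum>x\<in>B. (d * a x + c * b x) * x)"
      unfolding * by (simp add: sum_distrib_left sum.distrib algebra_simps)
    finally show "c * d * (s + t) = (\<Sum>x\<in>B. (d * a x + c * b x) * x)" .
  qed (use A * in \<open>auto intro: subring_intros\<close>)
qed

lemma frac_span_scale:
  assumes A: "is_subring A" and "s \<in> frac_span A B" "d \<in> A"
  shows "d * s \<in> frac_span A B"
proof -
  from assms obtain c a where *: "c \<in> A" "c \<noteq> 0" "\<And>x. a x \<in> A" "c * s = (\<Sum>x\<in>B. a x * x)"
    unfolding frac_span_def by blast
  show ?thesis
  proof (rule frac_spanI[where c = "c" and a = "\<lambda>x. d * a x"])
    have "c * (d * s) = d * (c * s)" by (simp add: algebra_simps)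
    also have "\<dots> = (\<Sum>x\<in>B. d * a x * x)"
      unfolding * by (simp add: sum_distrib_left algebra_simps)
    finally show "c * (d * s) = (\<Sum>x\<in>B. d * a x * x)" .
  qed (use A * assms in \<open>auto intro: subring_intros\<close>)
qed

lemma frac_span_uminus: "is_subring A \<Longrightarrow> s \<in> frac_span A B \<Longrightarrow> - s \<in> frac_span A B"
  using frac_span_scale[of A s B "-1"] by (auto intro: subring_intros)

lemma frac_span_sum:
  "is_subring A \<Longrightarrow> (\<And>i. i \<in> I \<Longrightarrow> g i \<in> frac_span A B) \<Longrightarrow> sum g I \<in> frac_span A B"
  by (induction I rule: infinite_finite_induct) (auto intro: frac_span_0 frac_span_add)

lemma frac_span_divide:
  assumes A: "is_subring A" and "d * s \<in> frac_span A B" "d \<in> A" "d \<noteq> 0"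
  shows "s \<in> frac_span A B"
proof -
  from assms obtain c a where *: "c \<in> A" "c \<noteq> 0" "\<And>x. a x \<in> A" "c * (d * s) = (\<Sum>x\<in>B. a x * x)"
    unfolding frac_span_def by blast
  show ?thesis
    by (rule frac_spanI[where c = "c * d" and a = a])
      (use A * assms in \<open>auto intro: subring_intros simp: mult.assoc\<close>)
qed

lemma frac_span_mult:
  assumes A: "is_subring A" and "s \<in> frac_span A B" "\<And>b. b \<in> B \<Longrightarrow> b * u \<in> frac_span A B'"
  shows "s * u \<in> frac_span A B'"
proof -
  from assms obtain c a where *: "c \<in> A" "c \<noteq> 0" "\<And>x. a x \<in> A" "c * s = (\<Sum>x\<in>B. a x * x)"
    unfolding frac_span_def by blast
  have "c * (s * u) = (\<Sum>x\<in>B. a x * (x * u))"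
    using *(4) by (simp flip: mult.assoc add: sum_distrib_right)
  also have "\<dots> \<in> frac_span A B'" using A assms(3) * by (intro frac_span_sum) (auto intro: frac_span_scale)
  finally show ?thesis using frac_span_divide A * by blast
qed

lemma multipliers_mult:
  "is_subring A \<Longrightarrow> s \<in> frac_span A B \<Longrightarrow> x \<in> multipliers A B \<Longrightarrow> x * s \<in> frac_span A B"
  using frac_span_mult[of A s B x B] by (auto simp: multipliers_def mult.commute)

lemma subset_multipliers: "is_subring A \<Longrightarrow> finite B \<Longrightarrow> A \<subseteq> multipliers A B"
  by (auto simp: multipliers_def intro: frac_span_scale frac_span_base)

lemma is_subring_multipliers:
  assumes A: "is_subring A" and "finite B"
  shows "is_subring (multipliers A B)"
proof -
  have "1 \<in> multipliers A B"
    using assms subset_multipliers subring_one by blast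
  moreover have "x - y \<in> multipliers A B" if "x \<in> multipliers A B" "y \<in> multipliers A B" for x y
  proof -
    have "x * b + - (y * b) \<in> frac_span A B" if "b \<in> B" for b
      using that \<open>x \<in> _\<close> \<open>y \<in> _\<close> A
      by (intro frac_span_add frac_span_uminus) (auto simp: multipliers_def)
    then show ?thesis by (auto simp: multipliers_def algebra_simps)
  qed
  moreover have "x * y \<in> multipliers A B" if "x \<in> multipliers A B" "y \<in> multipliers A B" for x y
    using that multipliers_mult[OF A, of _ B x] by (auto simp: multipliers_def mult.assoc)
  ultimately show ?thesis by (auto simp: is_subring_def)
qed

definition algebraic_over :: "'s::idom set \<Rightarrow> 's \<Rightarrow> bool" where
  "algebraic_over A x \<longleftrightarrow> (\<exists>p. p \<noteq> 0 \<and> (\<forall>i. coeff p i \<in> A) \<and> poly p x = 0)"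

text \<open>The \<open>card B + 1\<close> powers of x up to exponent \<open>card B\<close> lie in a
  space spanned by \<open>card B\<close> elements, hence are linearly dependent.\<close>

lemma algebraic_over_multiplier:
  assumes A: "is_subring A" and B: "finite B" "1 \<in> B" and x: "x \<in> multipliers A B"
  shows "algebraic_over A x"
proof -
  have pow: "x ^ i \<in> frac_span A B" for i
    by (induction i) (use assms in \<open>auto intro: frac_span_base multipliers_mult\<close>)
  then have "\<forall>i. \<exists>c a. c \<in> A \<and> c \<noteq> 0 \<and> (\<forall>b. a b \<in> A) \<and> c * x ^ i = (\<Sum>b\<in>B. a b * b)"
    unfolding frac_span_def by blast
  then obtain c a where *: "\<And>i. c i \<in> A" "\<And>i. c i \<noteq> 0" "\<And>i b. a i b \<in> A"
    "\<And>i. c i * x ^ i = (\<Sum>b\<in>B. a i b * b)" by metis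
  define J where "J = {..card B}"
  obtain v where v: "\<And>j. v j \<in> A" "\<exists>j\<in>J. v j \<noteq> 0" "\<And>b. b \<in> B \<Longrightarrow> (\<Sum>j\<in>J. a j b * v j) = 0"
    using homogeneous_system_nontrivial_solution[OF A B(1), of J "\<lambda>b j. a j b"] *(3)
    by (metis J_def card_atMost finite_atMost lessI)
  \<comment> \<open>\<open>c j\<close> is the denominator of \<open>x ^ j\<close>; as it is
    non-zero, a non-zero \<open>v j\<close> leaves a non-zero coefficient.\<close>
  define p where "p = (\<Sum>j\<in>J. monom (v j * c j) j)"
  have cp: "coeff p i = (if i \<in> J then v i * c i else 0)" for i
    by (simp add: p_def coeff_sum J_def)
  have "poly p x = (\<Sum>j\<in>J. v j * (c j * x ^ j))"
    by (simp add: p_def poly_sum poly_monom mult.assoc)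
  also have "\<dots> = (\<Sum>j\<in>J. \<Sum>b\<in>B. a j b * v j * b)"
    unfolding * by (simp add: sum_distrib_left algebra_simps)
  also have "\<dots> = (\<Sum>b\<in>B. (\<Sum>j\<in>J. a j b * v j) * b)"
    by (subst sum.swap) (simp add: sum_distrib_right)
  also have "\<dots> = 0" using v(3) by simp
  finally have "poly p x = 0" .
  moreover have "p \<noteq> 0"
  proof
    assume "p = 0"
    obtain j where "j \<in> J" "v j \<noteq> 0" using v(2) by blast
    then have "coeff p j \<noteq> 0" using * by (simp add: cp)
    then show False using \<open>p = 0\<close> by simp
  qed
  moreover have "coeff p i \<in> A" for i using A * v by (auto simp: cp intro: subring_intros)
  ultimately show ?thesis unfolding algebraic_over_def by blast
qed

text \<open>\<open>B'\<close> consists of the products \<open>b * x ^ j\<close> with j below the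
  degree of p; p rewrites the one power that leaves this range. The leading coefficient is cancelled
  there, so it is required to lie in A, where \<open>frac_span\<close> allows denominators; for the
  other coefficients it suffices to be multipliers.\<close>

lemma multipliers_adjoin_root:
  assumes A: "is_subring A" and B: "finite B" "1 \<in> B"
    and p: "p \<noteq> 0" "poly p x = 0" "\<And>i. coeff p i \<in> multipliers A B" "lead_coeff p \<in> A"
  shows "\<exists>B'. finite B' \<and> 1 \<in> B' \<and> multipliers A B \<subseteq> multipliers A B' \<and> x \<in> multipliers A B'"
proof -
  define d where "d = degree p"
  have d: "d > 0"
  proof (rule ccontr)
    assume "\<not> d > 0"
    then obtain c where "p = [:c:]" using degree_eq_zeroE d_def by auto
    then show False using p by auto
  qed
  define B' where "B' = (\<lambda>(b, j). b * x ^ j) ` (B \<times> {..<d})"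
  have fin: "finite B'" using B by (simp add: B'_def)
  have mem: "b * x ^ j \<in> frac_span A B'" if "b \<in> B" "j < d" for b j
    using that by (intro frac_span_base A fin) (auto simp: B'_def)
  have shift: "s * x ^ j \<in> frac_span A B'" if "s \<in> frac_span A B" "j < d" for s j
    using frac_span_mult[OF A that(1)] mem that(2) by blast
  have "1 * x ^ 0 \<in> B'" unfolding B'_def using d B by (intro image_eqI[of _ _ "(1, 0)"]) auto
  then have "1 \<in> B'" by simp
  moreover have "multipliers A B \<subseteq> multipliers A B'"
  proof
    fix s assume s: "s \<in> multipliers A B"
    have "s * (b * x ^ j) \<in> frac_span A B'" if "b \<in> B" "j < d" for b j
      using shift[of "s * b" j] s that by (auto simp: multipliers_def mult.assoc)
    then show "s \<in> multipliers A B'" by (auto simp: multipliers_def B'_def)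
  qed
  moreover have "x \<in> multipliers A B'"
  proof -
    have "x * (b * x ^ j) \<in> frac_span A B'" if b: "b \<in> B" and j: "j < d" for b j
    proof (cases "Suc j < d")
      case True
      with mem[OF b True] show ?thesis by (simp add: algebra_simps)
    next
      case False
      then have sj: "Suc j = d" using j by auto
      have "0 = b * poly p x" using p by simp
      also have "\<dots> = (\<Sum>i<d. (coeff p i * b) * x ^ i) + lead_coeff p * (b * x ^ d)"
        unfolding poly_altdef d_def[symmetric]
        by (simp add: lessThan_Suc_atMost[symmetric] sum_distrib_left algebra_simps d_def)
      finally have "lead_coeff p * (b * x ^ d) = - (\<Sum>i<d. (coeff p i * b) * x ^ i)"
        by (simp add: eq_neg_iff_add_eq_0 add.commute)
      also have "\<dots> \<in> frac_span A B'"
        by (intro frac_span_uminus frac_span_sum A shift) (use p b in \<open>auto simp: multipliers_def\<close>)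
      finally have "b * x ^ d \<in> frac_span A B'"
        using A p frac_span_divide by (metis leading_coeff_0_iff)
      then show ?thesis by (simp add: sj[symmetric] algebra_simps)
    qed
    then show ?thesis by (auto simp: multipliers_def B'_def)
  qed
  ultimately show ?thesis using fin by blast
qed

lemma finite_algebraic_multipliers:
  assumes A: "is_subring A" and "finite F" "\<And>x. x \<in> F \<Longrightarrow> algebraic_over A x"
  shows "\<exists>B. finite B \<and> 1 \<in> B \<and> F \<subseteq> multipliers A B"
  using assms(2,3)
proof (induction F rule: finite_induct)
  case empty
  then show ?case by (intro exI[of _ "{1}"]) auto
next
  case (insert x F)
  then obtain B where B: "finite B" "1 \<in> B" "F \<subseteq> multipliers A B" by auto
  obtain p where p: "p \<noteq> 0" "poly p x = 0" "\<And>i. coeff p i \<in> A"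
    using insert.prems[of x] by (auto simp: algebraic_over_def)
  have "\<exists>B'. finite B' \<and> 1 \<in> B' \<and> multipliers A B \<subseteq> multipliers A B' \<and> x \<in> multipliers A B'"
    using subset_multipliers[OF A B(1)] p
    by (intro multipliers_adjoin_root[OF A B(1,2), of p]) auto
  then show ?case using B(3) by blast
qed

lemma algebraic_over_in:
  assumes A: "is_subring A" and "x \<in> A" shows "algebraic_over A x"
proof -
  have "coeff [:- x, 1:] i \<in> A" for i
    using assms by (auto simp: coeff_pCons split: nat.split intro: subring_intros)
  then show ?thesis unfolding algebraic_over_def by (intro exI[of _ "[:- x, 1:]"]) auto
qed

text \<open>Two algebraic elements lie in the multiplier ring of one finite set, and every
  multiplier is algebraic.\<close>

lemma is_subring_algebraic:
  assumes A: "is_subring A" shows "is_subring {x. algebraic_over A x}"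
proof -
  have "algebraic_over A (x - y) \<and> algebraic_over A (x * y)"
    if xy: "algebraic_over A x" "algebraic_over A y" for x y
  proof -
    obtain B where B: "finite B" "1 \<in> B" "{x, y} \<subseteq> multipliers A B"
      using finite_algebraic_multipliers[OF A, of "{x, y}"] xy by auto
    then have "x - y \<in> multipliers A B" "x * y \<in> multipliers A B"
      using is_subring_multipliers[OF A B(1)] by (auto intro: subring_intros)
    then show ?thesis using algebraic_over_multiplier[OF A B(1,2)] by blast
  qed
  then show ?thesis using algebraic_over_in[OF A] subring_one[OF A] by (auto simp: is_subring_def)
qed

text \<open>Stands in for the inverse of x: factors X are split off the relation until its constant
  term a is non-zero, and then \<open>a + x * poly p x = 0\<close> gives the multiplier
  \<open>- poly p x\<close>.\<close>

lemma algebraic_over_multiple_in: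
  assumes A: "is_subring A" and "algebraic_over A x" "x \<noteq> 0"
  shows "\<exists>e. algebraic_over A e \<and> e * x \<in> A \<and> e * x \<noteq> 0"
proof -
  have "\<exists>e. algebraic_over A e \<and> e * x \<in> A \<and> e * x \<noteq> 0"
    if "p \<noteq> 0" "\<forall>i. coeff p i \<in> A" "poly p x = 0" for p
    using that
  proof (induction p rule: pCons_induct)
    case 0
    then show ?case by simp
  next
    case (pCons a p)
    have cp: "coeff p i \<in> A" for i using pCons.prems(2) coeff_pCons_Suc by metis
    show ?case
    proof (cases "a = 0")
      case True
      then show ?thesis using pCons cp \<open>x \<noteq> 0\<close> by auto
    next
      case False
      have "a \<in> A" using pCons.prems(2) coeff_pCons_0 by metis
      have "poly p x \<in> {x. algebraic_over A x}"
        using algebraic_over_in[OF A] cp assms(2)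
        by (intro subring_poly is_subring_algebraic A) auto
      then have "- poly p x \<in> {x. algebraic_over A x}"
        by (intro subring_uminus is_subring_algebraic A)
      moreover have "- poly p x * x = a" using pCons.prems(3)
        by (simp add: mult.commute[of x] eq_neg_iff_add_eq_0 neg_eq_iff_add_eq_0 add.commute)
      ultimately show ?thesis using \<open>a \<in> A\<close> False by (intro exI[of _ "- poly p x"]) auto
    qed
  qed
  then show ?thesis using assms(2) unfolding algebraic_over_def by blast
qed

text \<open>The leading coefficient of p is only algebraic, while
  \<open>multipliers_adjoin_root\<close> wants it in A; the factor e moves it there and keeps the
  other coefficients algebraic.\<close>

lemma algebraic_over_trans:
  assumes A: "is_subring A" and "algebraic_over {x. algebraic_over A x} x"
  shows "algebraic_over A x"
proof -
  note sr = is_subring_algebraic[OF A]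
  obtain p where p: "p \<noteq> 0" "poly p x = 0" "\<And>i. algebraic_over A (coeff p i)"
    using assms(2) by (auto simp: algebraic_over_def[of "{x. algebraic_over A x}"])
  obtain e where e: "algebraic_over A e" "e * lead_coeff p \<in> A" "e * lead_coeff p \<noteq> 0"
    using algebraic_over_multiple_in[OF A p(3)[of "degree p"]] p(1) by auto
  define q where "q = smult e p"
  have q: "q \<noteq> 0" "poly q x = 0" "lead_coeff q \<in> A" using p e by (auto simp: q_def)
  have cq: "algebraic_over A (coeff q i)" for i
    using subring_mult[OF sr] e(1) p(3) by (simp add: q_def)
  have "finite (range (coeff q))"
  proof (rule finite_subset)
    show "range (coeff q) \<subseteq> insert 0 (coeff q ` {..degree q})"
    proof
      fix c assume "c \<in> range (coeff q)"
      then obtain i where "c = coeff q i" by blast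
      then show "c \<in> insert 0 (coeff q ` {..degree q})"
        by (cases "i \<le> degree q") (auto simp: coeff_eq_0)
    qed
  qed auto
  then obtain B where B: "finite B" "1 \<in> B" "range (coeff q) \<subseteq> multipliers A B"
    using finite_algebraic_multipliers[OF A, of "range (coeff q)"] cq by auto
  then obtain B' where "finite B'" "1 \<in> B'" "x \<in> multipliers A B'"
    using multipliers_adjoin_root[OF A B(1,2) q(1,2) _ q(3)] by auto
  then show ?thesis using algebraic_over_multiplier[OF A] by blast
qed

section \<open>The relative algebraic closure: a closure operator with exchange\<close>

text \<open>The ring is generated by G and 1 alone, so constants have to be included in G.\<close>

definition alg_cl :: "'s::idom set \<Rightarrow> 's set" where
  "alg_cl G = {x. algebraic_over (ring_gen G) x}"

lemma is_subring_alg_cl: "is_subring (alg_cl G)"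
  unfolding alg_cl_def by (intro is_subring_algebraic is_subring_ring_gen)

lemmas alg_cl_intros = subring_intros[OF is_subring_alg_cl]

lemma ring_gen_subset_alg_cl: "ring_gen G \<subseteq> alg_cl G"
  using algebraic_over_in[OF is_subring_ring_gen] by (auto simp: alg_cl_def)

lemma subset_alg_cl: "G \<subseteq> alg_cl G"
  using ring_gen_subset_alg_cl ring_gen.base by blast

lemma alg_cl_mono: "G \<subseteq> H \<Longrightarrow> alg_cl G \<subseteq> alg_cl H"
  unfolding alg_cl_def algebraic_over_def using ring_gen_mono[of G H] by blast

lemma alg_cl_idem: "alg_cl (alg_cl G) = alg_cl G"
  using algebraic_over_trans[OF is_subring_ring_gen[of G]] subset_alg_cl[of "alg_cl G"]
    ring_gen_subring[OF is_subring_alg_cl[of G]]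
  by (auto simp: alg_cl_def)

lemma alg_cl_least: "G \<subseteq> alg_cl H \<Longrightarrow> alg_cl G \<subseteq> alg_cl H"
  using alg_cl_mono[of G "alg_cl H"] by (simp add: alg_cl_idem)

lemma alg_clI:
  assumes "p \<noteq> 0" "\<And>i. coeff p i \<in> alg_cl G" "poly p x = 0"
  shows "x \<in> alg_cl G"
proof -
  have "algebraic_over (ring_gen (alg_cl G)) x"
    unfolding algebraic_over_def using assms ring_gen.base by blast
  then show ?thesis using alg_cl_idem[of G] by (auto simp: alg_cl_def[of "alg_cl G"])
qed

text \<open>Plays the role of closure under fractions: x is a root of the linear polynomial a X - a
  x.\<close>

lemma alg_cl_divide:
  assumes "a * x \<in> alg_cl G" "a \<in> alg_cl G" "a \<noteq> 0"
  shows "x \<in> alg_cl G"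
proof (rule alg_clI[of "[:- (a * x), a:]"])
  show "coeff [:- (a * x), a:] i \<in> alg_cl G" for i
    using assms by (auto simp: coeff_pCons split: nat.split intro: alg_cl_intros)
qed (use assms in \<open>auto simp: algebra_simps\<close>)

text \<open>Steinitz exchange. A relation for x over G and y is a polynomial in both; read as a
  polynomial r in y it has coefficients in the ring generated by G and x. If r vanished, some
  non-zero \<open>s i\<close> would make x algebraic over G alone.\<close>

lemma alg_cl_exchange:
  assumes "x \<in> alg_cl (insert y G)" "x \<notin> alg_cl G"
  shows "y \<in> alg_cl (insert x G)"
proof -
  obtain p where p: "p \<noteq> 0" "\<And>i. coeff p i \<in> ring_gen (insert y G)" "poly p x = 0"
    using assms by (auto simp: alg_cl_def algebraic_over_def)
  have "\<exists>q. (\<forall>i. coeff q i \<in> ring_gen G) \<and> coeff p j = poly q y" for j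
    using ring_gen_insert[OF p(2)[of j]] by metis
  then obtain q where q: "\<And>j i. coeff (q j) i \<in> ring_gen G" "\<And>j. coeff p j = poly (q j) y"
    by metis
  define d where "d = degree p"
  define r where "r = (\<Sum>j\<le>d. smult (x ^ j) (q j))"
  define s where "s i = (\<Sum>j\<le>d. monom (coeff (q j) i) j)" for i
  have cr: "coeff r i = poly (s i) x" for i
    by (simp add: r_def s_def coeff_sum poly_sum poly_monom mult.commute)
  have cs: "coeff (s i) j = (if j \<le> d then coeff (q j) i else 0)" for i j
    by (simp add: s_def coeff_sum)
  have "poly r y = poly p x"
    by (simp add: r_def poly_sum poly_altdef[of p] d_def q(2) mult.commute)
  then have "poly r y = 0" using p by simp
  moreover have "r \<noteq> 0"
  proof
    assume "r = 0"
    have "coeff p d \<noteq> 0" using p by (simp add: d_def)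
    then have "q d \<noteq> 0" using q(2)[of d] by auto
    then obtain i where "coeff (q d) i \<noteq> 0" by (metis leading_coeff_0_iff)
    then have "s i \<noteq> 0" using cs[of i d] by auto
    moreover have "poly (s i) x = 0" using \<open>r = 0\<close> cr[of i] by simp
    moreover have "coeff (s i) j \<in> ring_gen G" for j
      using q(1) is_subring_ring_gen[of G] by (auto simp: cs intro: subring_intros)
    ultimately have "x \<in> alg_cl G" unfolding alg_cl_def algebraic_over_def by blast
    then show False using assms by simp
  qed
  moreover have "coeff r i \<in> alg_cl (insert x G)" for i
    unfolding cr
  proof (rule subring_poly[OF is_subring_alg_cl])
    have "ring_gen G \<subseteq> alg_cl (insert x G)"
      using ring_gen_mono[of G "insert x G"] ring_gen_subset_alg_cl by blast
    then show "coeff (s i) j \<in> alg_cl (insert x G)" for j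
      using q(1) by (auto simp: cs intro: alg_cl_intros)
    show "x \<in> alg_cl (insert x G)" using subset_alg_cl by blast
  qed
  ultimately show ?thesis using alg_clI by blast
qed

text \<open>Turns a finite bound on the transcendence degree into a relation of one
  \<open>v m\<close> over its predecessors, the form that a differential equation has. Elements of X
  are exchanged one at a time for \<open>v 0\<close>, \<open>v 1\<close>, ..., which move into G;
  hence the generalisation over G and v.\<close>

lemma alg_cl_finite_rank:
  fixes v :: "nat \<Rightarrow> 's::idom"
  assumes "finite X" "\<And>i. v i \<in> alg_cl (G \<union> X)"
  shows "\<exists>m. v m \<in> alg_cl (G \<union> v ` {..<m})"
  using assms
proof (induction "card X" arbitrary: X v G rule: less_induct)
  case less
  define \<F> where "\<F> = {Y. Y \<subseteq> X \<and> v 0 \<in> alg_cl (G \<union> Y)}"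
  have "finite \<F>" "X \<in> \<F>" using less.prems by (auto simp: \<F>_def)
  then obtain Y where Y: "Y \<in> \<F>" and min: "\<And>Z. Z \<in> \<F> \<Longrightarrow> Z \<subseteq> Y \<Longrightarrow> Z = Y"
    using finite_has_minimal[of \<F>] by blast
  show ?case
  proof (cases "Y = {}")
    case True
    then have "v 0 \<in> alg_cl (G \<union> v ` {..<0})" using Y by (auto simp: \<F>_def)
    then show ?thesis by blast
  next
    case False
    then obtain y where y: "y \<in> Y" by blast
    have YX: "Y \<subseteq> X" and v0: "v 0 \<in> alg_cl (G \<union> Y)" using Y by (auto simp: \<F>_def)
    have "Y - {y} \<notin> \<F>" using min[of "Y - {y}"] y by auto
    then have "v 0 \<notin> alg_cl (G \<union> (Y - {y}))" using YX by (auto simp: \<F>_def)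
    moreover have "insert y (G \<union> (Y - {y})) = G \<union> Y" using y by auto
    ultimately have ycl: "y \<in> alg_cl (insert (v 0) (G \<union> (Y - {y})))"
      using alg_cl_exchange v0 by metis
    define X' where "X' = X - {y}"
    define G' where "G' = insert (v 0) G"
    have "insert (v 0) (G \<union> (Y - {y})) \<subseteq> G' \<union> X'" using YX by (auto simp: X'_def G'_def)
    then have "y \<in> alg_cl (G' \<union> X')" using ycl alg_cl_mono by blast
    then have "G \<union> X \<subseteq> alg_cl (G' \<union> X')"
      using subset_alg_cl[of "G' \<union> X'"] by (auto simp: X'_def G'_def)
    then have "v (Suc i) \<in> alg_cl (G' \<union> X')" for i
      using alg_cl_least less.prems(2) by blast
    moreover have "card X' < card X" "finite X'"
      using y YX less.prems(1) by (auto simp: X'_def intro: psubset_card_mono)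
    ultimately obtain m where m: "v (Suc m) \<in> alg_cl (G' \<union> (\<lambda>i. v (Suc i)) ` {..<m})"
      using less.hyps[of X' "\<lambda>i. v (Suc i)" G'] by blast
    moreover have "G' \<union> (\<lambda>i. v (Suc i)) ` {..<m} = G \<union> v ` {..<Suc m}"
      by (auto simp: G'_def lessThan_Suc_eq_insert_0 image_image)
    ultimately show ?thesis by metis
  qed
qed

section \<open>Derivations\<close>

definition is_derivation :: "('s::comm_ring_1 \<Rightarrow> 's) \<Rightarrow> bool" where
  "is_derivation \<delta> \<longleftrightarrow>
     (\<forall>a b. \<delta> (a + b) = \<delta> a + \<delta> b) \<and> (\<forall>a b. \<delta> (a * b) = \<delta> a * b + a * \<delta> b)"

lemma
  assumes "is_derivation \<delta>"
  shows derivation_add: "\<delta> (a + b) = \<delta> a + \<delta> b"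
    and derivation_mult: "\<delta> (a * b) = \<delta> a * b + a * \<delta> b"
  using assms by (auto simp: is_derivation_def)

lemma derivation_0: "is_derivation \<delta> \<Longrightarrow> \<delta> 0 = 0"
  using derivation_add[of \<delta> 0 0] by simp

lemma derivation_1: "is_derivation \<delta> \<Longrightarrow> \<delta> 1 = 0"
  using derivation_mult[of \<delta> 1 1] by simp

lemma derivation_diff: "is_derivation \<delta> \<Longrightarrow> \<delta> (a - b) = \<delta> a - \<delta> b"
  using derivation_add[of \<delta> "a - b" b] by simp

lemma derivation_sum: "is_derivation \<delta> \<Longrightarrow> \<delta> (sum g I) = (\<Sum>i\<in>I. \<delta> (g i))"
  by (induction I rule: infinite_finite_induct) (auto simp: derivation_0 derivation_add)

lemma derivation_poly:
  assumes "is_derivation \<delta>"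
  shows "\<delta> (poly p x) = poly (map_poly \<delta> p) x + poly (pderiv p) x * \<delta> x"
  using assms
  by (induction p)
     (simp_all add: derivation_0 derivation_add derivation_mult map_poly_pCons pderiv_pCons algebra_simps)

lemma derivation_funpow_mult:
  assumes "is_derivation \<delta>"
  shows "(\<delta> ^^ n) (a * b) = (\<Sum>k\<le>n. of_nat (n choose k) * ((\<delta> ^^ k) a * (\<delta> ^^ (n - k)) b))"
    (is "_ = ?S n")
proof (induction n)
  case 0
  then show ?case by simp
next
  case (Suc n)
  have of_nat0: "\<delta> (of_nat m * c) = of_nat m * \<delta> c" for m c
    by (induction m) (simp_all add: derivation_0 derivation_add assms algebra_simps)
  let ?t = "\<lambda>k l. (\<delta> ^^ k) a * (\<delta> ^^ l) b"
  have "(\<delta> ^^ Suc n) (a * b) =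
      (\<Sum>k\<le>n. of_nat (n choose k) * ?t (Suc k) (n - k)) + (\<Sum>k\<le>n. of_nat (n choose k) * ?t k (Suc (n - k)))"
    unfolding funpow.simps o_def Suc derivation_sum[OF assms] of_nat0
    by (simp add: derivation_mult[OF assms] ring_distribs sum.distrib)
  \<comment> \<open>The added term k = Suc n has binomial coefficient 0; splitting off k = 0
    afterwards leaves the range of the first sum, ready for Pascal's rule.\<close>
  also have "(\<Sum>k\<le>n. of_nat (n choose k) * ?t k (Suc (n - k))) =
      (\<Sum>k\<le>Suc n. of_nat (n choose k) * ?t k (Suc n - k))"
    by (simp add: Suc_diff_le binomial_eq_0)
  also have "\<dots> = ?t 0 (Suc n) + (\<Sum>k\<le>n. of_nat (n choose Suc k) * ?t (Suc k) (n - k))"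
    by (subst sum.atMost_Suc_shift) simp
  also have "(\<Sum>k\<le>n. of_nat (n choose k) * ?t (Suc k) (n - k)) + \<dots> =
      ?t 0 (Suc n) + (\<Sum>k\<le>n. of_nat (Suc n choose Suc k) * ?t (Suc k) (n - k))"
    by (simp add: algebra_simps sum.distrib)
  also have "\<dots> = ?S (Suc n)"
    by (subst (1) sum.atMost_Suc_shift) simp
  finally show ?case .
qed

text \<open>Apply \<open>\<delta>\<close> to a polynomial relation of minimal degree: its separant does not vanish.\<close>

lemma derivation_alg_cl:
  fixes \<delta> :: "'s::idom \<Rightarrow> 's"
  assumes \<delta>: "is_derivation \<delta>" and char0: "\<And>n. n > 0 \<Longrightarrow> of_nat n \<noteq> (0 :: 's)"
    and GH: "G \<subseteq> H" and \<delta>G: "\<delta> ` G \<subseteq> alg_cl H" and x: "x \<in> alg_cl G"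
  shows "\<delta> x \<in> alg_cl H"
proof -
  \<comment> \<open>The larger set H receives the values of \<delta>, which need not be algebraic
    over G.\<close>
  have GH': "alg_cl G \<subseteq> alg_cl H" using GH by (rule alg_cl_mono)
  have gen: "\<delta> a \<in> alg_cl H" if "a \<in> ring_gen G" for a
    using that
  proof induction
    case (mult a b)
    then have "a \<in> alg_cl H" "b \<in> alg_cl H"
      using ring_gen_subset_alg_cl GH' by blast+
    with mult show ?case by (auto simp: derivation_mult[OF \<delta>] intro!: alg_cl_intros)
  qed (use \<delta>G in \<open>auto simp: derivation_1[OF \<delta>] derivation_diff[OF \<delta>] intro: alg_cl_intros\<close>)
  define Q where "Q p \<longleftrightarrow> p \<noteq> 0 \<and> (\<forall>i. coeff p i \<in> ring_gen G) \<and> poly p x = 0" for p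
  have "\<exists>p. Q p" using x by (auto simp: alg_cl_def algebraic_over_def Q_def)
  then obtain p where p: "Q p" and min: "\<And>q. Q q \<Longrightarrow> degree p \<le> degree q"
    using ex_has_least_nat[of Q _ degree] by blast
  have cp: "coeff p i \<in> ring_gen G" and cp': "coeff p i \<in> alg_cl H" for i
    using p ring_gen_subset_alg_cl GH' by (auto simp: Q_def)
  have deg: "degree p > 0"
  proof (rule ccontr)
    assume "\<not> degree p > 0"
    then obtain c where "p = [:c:]" using degree_eq_zeroE by auto
    then show False using p by (auto simp: Q_def)
  qed
  \<comment> \<open>Characteristic 0 keeps the derivative of p non-zero, and by minimality of the
    degree it cannot vanish at x.\<close>
  have "coeff (pderiv p) (degree p - 1) = of_nat (degree p) * lead_coeff p"
    using deg by (simp add: coeff_pderiv flip: of_nat_Suc)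
  then have "coeff (pderiv p) (degree p - 1) \<noteq> 0" using deg char0[of "degree p"] p by (auto simp: Q_def)
  then have "pderiv p \<noteq> 0" by auto
  moreover have "degree (pderiv p) < degree p"
    using deg by (intro le_less_trans[OF degree_le[of "degree p - 1"]]) (auto simp: coeff_pderiv coeff_eq_0)
  moreover have "coeff (pderiv p) i \<in> ring_gen G" for i
    unfolding coeff_pderiv using is_subring_ring_gen[of G] cp by (blast intro: subring_intros)
  ultimately have "poly (pderiv p) x \<noteq> 0" using min[of "pderiv p"] by (auto simp: Q_def)
  moreover have "poly (pderiv p) x \<in> alg_cl H"
    using cp' x GH' unfolding coeff_pderiv
    by (intro subring_poly is_subring_alg_cl) (auto simp: coeff_pderiv simp del: of_nat_Suc intro: alg_cl_intros)
  moreover have "poly (pderiv p) x * \<delta> x = - poly (map_poly \<delta> p) x"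
    using derivation_poly[OF \<delta>, of p x] p derivation_0[OF \<delta>]
    by (simp add: Q_def eq_neg_iff_add_eq_0 add.commute)
  moreover have "- poly (map_poly \<delta> p) x \<in> alg_cl H"
    using gen cp x GH' derivation_0[OF \<delta>]
    by (intro alg_cl_intros subring_poly is_subring_alg_cl) (auto simp: coeff_map_poly)
  ultimately show ?thesis using alg_cl_divide by metis
qed

corollary derivation_funpow_alg_cl:
  fixes \<delta> :: "'s::idom \<Rightarrow> 's"
  assumes "is_derivation \<delta>" "\<And>n. n > 0 \<Longrightarrow> of_nat n \<noteq> (0 :: 's)"
    and "\<delta> ` G \<subseteq> alg_cl G" "x \<in> alg_cl G"
  shows "(\<delta> ^^ i) x \<in> alg_cl G"
proof (induction i)
  case (Suc i)
  then show ?case using derivation_alg_cl[OF assms(1,2) order_refl assms(3)] by simp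
qed (use assms in simp)

section \<open>Differential algebraicity and algebraic closure\<close>

text \<open>Exponents are plain functions, of which only the values below m count; single exponents
  can then be changed by function update.\<close>

definition power_prod :: "(nat \<Rightarrow> 's::comm_ring_1) \<Rightarrow> nat \<Rightarrow> (nat \<Rightarrow> nat) \<Rightarrow> 's" where
  "power_prod v m k = (\<Prod>j<m. v j ^ k j)"

text \<open>Induction on m: sorting the monomials by their exponent at the last variable gives a
  polynomial in that variable, whose coefficients vanish because the variable is transcendental over
  the earlier ones. Members of K are separated below m, as equal monomials could cancel.\<close>

lemma power_prod_linear_independent:
  fixes v :: "nat \<Rightarrow> 's::idom"
  assumes R: "is_subring R" and trans: "\<And>i. i < m \<Longrightarrow> v i \<notin> alg_cl (R \<union> v ` {..<i})"
    and "finite K" "\<And>k l. k \<in> K \<Longrightarrow> l \<in> K \<Longrightarrow> (\<And>j. j < m \<Longrightarrow> k j = l j) \<Longrightarrow> k = l"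
    and "\<And>k. k \<in> K \<Longrightarrow> c k \<in> R" "(\<Sum>k\<in>K. c k * power_prod v m k) = 0" "k \<in> K"
  shows "c k = 0"
  using assms(2-)
proof (induction m arbitrary: K k)
  case 0
  \<comment> \<open>All members of K agree on the empty range of indices, so there is only
    one.\<close>
  then have "K = {k}" by blast
  with 0 show ?case by (simp add: power_prod_def)
next
  case (Suc m)
  define a where "a i = (\<Sum>k\<in>{k\<in>K. k m = i}. c k * power_prod v m k)" for i
  define p where "p = (\<Sum>i\<in>(\<lambda>k. k m) ` K. monom (a i) i)"
  have cp: "coeff p i = (if i \<in> (\<lambda>k. k m) ` K then a i else 0)" for i
    unfolding p_def using Suc.prems(2) by (simp add: coeff_sum)
  let ?G = "R \<union> v ` {..<m}"
  note sr = is_subring_ring_gen[of ?G]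
  have "c k \<in> ring_gen ?G" if "k \<in> K" for k
    using Suc.prems(4) that by (auto intro: ring_gen.base)
  then have "a i \<in> ring_gen ?G" for i
    unfolding a_def power_prod_def
    by (intro subring_sum subring_mult subring_prod subring_power sr) (auto intro: ring_gen.base)
  then have "\<forall>i. coeff p i \<in> ring_gen ?G" using sr by (auto simp: cp intro: subring_zero)
  moreover have "poly p (v m) = 0"
  proof -
    have "poly p (v m) = (\<Sum>i\<in>(\<lambda>k. k m) ` K. \<Sum>k\<in>{k\<in>K. k m = i}. c k * power_prod v (Suc m) k)"
      by (simp add: p_def poly_sum poly_monom a_def sum_distrib_right power_prod_def mult.assoc)
    also have "\<dots> = (\<Sum>k\<in>K. c k * power_prod v (Suc m) k)"
      using Suc.prems(2) by (intro sum.group) auto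
    finally show ?thesis using Suc.prems by simp
  qed
  moreover have "v m \<notin> alg_cl ?G" using Suc.prems(1) by auto
  ultimately have "p = 0" by (auto simp: alg_cl_def algebraic_over_def)
  then have "a (k m) = 0" using cp[of "k m"] Suc.prems(6) by auto
  then have sum0: "(\<Sum>l\<in>{l\<in>K. l m = k m}. c l * power_prod v m l) = 0" by (simp add: a_def)
  have inj: "k1 = k2" if "k1 \<in> {l\<in>K. l m = k m}" "k2 \<in> {l\<in>K. l m = k m}"
    "\<And>j. j < m \<Longrightarrow> k1 j = k2 j" for k1 k2
    using that by (intro Suc.prems(3)) (auto simp: less_Suc_eq)
  show ?case
    by (rule Suc.IH[OF _ _ inj _ sum0]) (use Suc.prems in auto)
qed

text \<open>Exponents vanish from m on, so that position m is free to record the power of a further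
  variable.\<close>

definition power_prod_comb ::
    "(nat \<Rightarrow> 's::comm_ring_1) \<Rightarrow> 's set \<Rightarrow> nat \<Rightarrow> (nat \<Rightarrow> nat) set \<Rightarrow> ((nat \<Rightarrow> nat) \<Rightarrow> 's) \<Rightarrow> 's \<Rightarrow> bool"
where
  "power_prod_comb v R m K c a \<longleftrightarrow> finite K \<and> (\<forall>k\<in>K. \<forall>j\<ge>m. k j = 0) \<and> (\<forall>k\<in>K. c k \<in> R) \<and>
     a = (\<Sum>k\<in>K. c k * power_prod v m k)"

text \<open>\<open>k(m := i)\<close> encodes the monomial k times the i-th power of
  \<open>v m\<close>; this is injective because k is 0 at m. Index set and coefficients are explicit
  because a non-zero coefficient has to be traced through them later.\<close>

lemma power_prod_comb_poly:
  assumes "\<And>i. power_prod_comb v R m (K i) (c i) (coeff p i)"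
  shows "power_prod_comb v R (Suc m) ((\<lambda>(i, k). k(m := i)) ` (SIGMA i:{..degree p}. K i))
           (\<lambda>k. c (k m) (k(m := 0))) (poly p (v m))" (is "power_prod_comb v R _ ?K ?c _")
proof -
  have fin: "finite (K i)" and K0: "\<And>k j. k \<in> K i \<Longrightarrow> j \<ge> m \<Longrightarrow> k j = 0"
    and R: "\<And>k. k \<in> K i \<Longrightarrow> c i k \<in> R"
    and sum: "coeff p i = (\<Sum>k\<in>K i. c i k * power_prod v m k)" for i
    using assms[of i] by (auto simp: power_prod_comb_def)
  have upd: "k(m := 0) = k" if "k \<in> K i" for k i
    using K0[OF that, of m] by auto
  have inj: "inj_on (\<lambda>(i, k). k(m := i)) (SIGMA i:{..degree p}. K i)"
  proof (rule inj_onI, clarify)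
    fix i k j l assume *: "k \<in> K i" "l \<in> K j" "k(m := i) = l(m := j)"
    then have "i = j" by (metis fun_upd_same)
    with * upd show "i = j \<and> k = l" by (metis fun_upd_upd)
  qed
  have "(\<Sum>k\<in>?K. ?c k * power_prod v (Suc m) k) =
      (\<Sum>(i, k)\<in>(SIGMA i:{..degree p}. K i). c i k * power_prod v m k * v m ^ i)"
    unfolding sum.reindex[OF inj] o_def
    by (intro sum.cong) (auto simp: upd power_prod_def mult.assoc)
  also have "\<dots> = (\<Sum>i\<le>degree p. \<Sum>k\<in>K i. c i k * power_prod v m k * v m ^ i)"
    using fin by (subst sum.Sigma) auto
  also have "\<dots> = poly p (v m)" by (simp add: poly_altdef sum sum_distrib_right)
  finally show ?thesis
    using fin R K0 by (auto simp: power_prod_comb_def upd)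
qed

lemma ring_gen_power_prod_comb:
  assumes R: "is_subring R" and "a \<in> ring_gen (R \<union> v ` {..<m})"
  shows "\<exists>K c. power_prod_comb v R m K c a"
  using assms(2)
proof (induction m arbitrary: a)
  case 0
  then have "a \<in> R" using ring_gen_subring[OF R] by simp
  then show ?case
    by (intro exI[of _ "{\<lambda>_. 0}"] exI[of _ "\<lambda>_. a"]) (simp add: power_prod_comb_def power_prod_def)
next
  case (Suc m)
  have "R \<union> v ` {..<Suc m} = insert (v m) (R \<union> v ` {..<m})" by (auto simp: less_Suc_eq)
  then obtain p where p: "\<And>i. coeff p i \<in> ring_gen (R \<union> v ` {..<m})" "a = poly p (v m)"
    using Suc.prems ring_gen_insert by metis
  then have "\<forall>i. \<exists>K c. power_prod_comb v R m K c (coeff p i)" using Suc.IH by blast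
  then obtain K c where "\<And>i. power_prod_comb v R m (K i) (c i) (coeff p i)" by metis
  from power_prod_comb_poly[OF this] p show ?case by blast
qed

lemma diffpoly_eval_power_prod:
  assumes "\<And>\<kappa>. \<kappa> \<in> Poly_Mapping.keys P \<Longrightarrow> Poly_Mapping.keys \<kappa> \<subseteq> {..<m}"
  shows "diffpoly_eval \<delta> P y = (\<Sum>\<kappa>\<in>Poly_Mapping.keys P.
           Poly_Mapping.lookup P \<kappa> * power_prod (\<lambda>i. (\<delta> ^^ i) y) m (Poly_Mapping.lookup \<kappa>))"
  unfolding diffpoly_eval_def power_prod_def
proof (intro sum.cong refl arg_cong2[of _ _ _ _ "(*)"])
  fix \<kappa> assume "\<kappa> \<in> Poly_Mapping.keys P"
  from assms[OF this]
  show "(\<Prod>i\<in>Poly_Mapping.keys \<kappa>. (\<delta> ^^ i) y ^ Poly_Mapping.lookup \<kappa> i) =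
      (\<Prod>j<m. (\<delta> ^^ j) y ^ Poly_Mapping.lookup \<kappa> j)"
    by (intro prod.mono_neutral_left) (auto simp: in_keys_iff)
qed

text \<open>If no derivative is algebraic over its predecessors, the monomials of P are linearly
  independent over R, a contradiction. Conversely, an algebraic relation for the m-th derivative is
  expanded into monomials to give P.\<close>

lemma differentially_algebraic_iff_alg_cl:
  fixes \<delta> :: "'s::idom \<Rightarrow> 's"
  assumes R: "is_subring R"
  shows "differentially_algebraic \<delta> R y \<longleftrightarrow>
     (\<exists>m. (\<delta> ^^ m) y \<in> alg_cl (R \<union> (\<lambda>i. (\<delta> ^^ i) y) ` {..<m}))"
proof
  let ?v = "\<lambda>i. (\<delta> ^^ i) y"
  assume "differentially_algebraic \<delta> R y"
  then obtain P :: "(nat \<Rightarrow>\<^sub>0 nat) \<Rightarrow>\<^sub>0 's" where P: "P \<noteq> 0"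
    "\<And>\<kappa>. Poly_Mapping.lookup P \<kappa> \<in> R" "diffpoly_eval \<delta> P y = 0"
    unfolding differentially_algebraic_def by blast
  define I where "I = (\<Union>\<kappa>\<in>Poly_Mapping.keys P. Poly_Mapping.keys \<kappa>)"
  have "finite I" by (auto simp: I_def)
  then obtain m where "I \<subseteq> {..<m}" using finite_nat_iff_bounded by blast
  then have m: "Poly_Mapping.keys \<kappa> \<subseteq> {..<m}" if "\<kappa> \<in> Poly_Mapping.keys P" for \<kappa>
    using that by (auto simp: I_def)
  let ?K = "Poly_Mapping.lookup ` Poly_Mapping.keys P"
  let ?c = "\<lambda>k. Poly_Mapping.lookup P (Abs_poly_mapping k)"
  have inj: "inj_on Poly_Mapping.lookup (Poly_Mapping.keys P)"
    by (auto intro: inj_onI poly_mapping_eqI)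
  have sum0: "(\<Sum>k\<in>?K. ?c k * power_prod ?v m k) = 0"
    using P(3) diffpoly_eval_power_prod[of P m \<delta> y, OF m]
    by (simp add: sum.reindex[OF inj] lookup_inverse)
  obtain \<kappa> where \<kappa>: "\<kappa> \<in> Poly_Mapping.keys P" using P(1) by fastforce
  have sep: "k = l" if kl: "k \<in> ?K" "l \<in> ?K" "\<And>j. j < m \<Longrightarrow> k j = l j" for k l
  proof
    fix j
    from kl(1,2) obtain \<kappa> \<mu> where *: "\<kappa> \<in> Poly_Mapping.keys P" "\<mu> \<in> Poly_Mapping.keys P"
      "k = Poly_Mapping.lookup \<kappa>" "l = Poly_Mapping.lookup \<mu>" by auto
    show "k j = l j"
      using m[OF *(1)] m[OF *(2)] kl(3)[of j] unfolding *(3,4)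
      by (metis in_keys_iff lessThan_iff subsetD)
  qed
  show "\<exists>m. (\<delta> ^^ m) y \<in> alg_cl (R \<union> ?v ` {..<m})"
  proof (rule ccontr)
    assume "\<nexists>m. (\<delta> ^^ m) y \<in> alg_cl (R \<union> ?v ` {..<m})"
    then have trans: "?v i \<notin> alg_cl (R \<union> ?v ` {..<i})" for i by blast
    have "?c (Poly_Mapping.lookup \<kappa>) = 0"
      by (rule power_prod_linear_independent[OF R trans _ sep _ sum0]) (use P(2) \<kappa> in auto)
    then show False using \<kappa> by (simp add: lookup_inverse in_keys_iff)
  qed
next
  let ?v = "\<lambda>i. (\<delta> ^^ i) y"
  assume "\<exists>m. (\<delta> ^^ m) y \<in> alg_cl (R \<union> ?v ` {..<m})"
  then obtain m p where p: "p \<noteq> 0" "\<And>i. coeff p i \<in> ring_gen (R \<union> ?v ` {..<m})" "poly p (?v m) = 0"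
    by (auto simp: alg_cl_def algebraic_over_def)
  then have "\<forall>i. \<exists>K c. power_prod_comb ?v R m K c (coeff p i)"
    using ring_gen_power_prod_comb[OF R, of _ ?v m] by blast
  then obtain K c where Kc: "\<And>i. power_prod_comb ?v R m (K i) (c i) (coeff p i)" by metis
  define K' where "K' = (\<lambda>(i, k). k(m := i)) ` (SIGMA i:{..degree p}. K i)"
  define c' where "c' k = c (k m) (k(m := 0))" for k
  have comb: "power_prod_comb ?v R (Suc m) K' c' 0"
    using power_prod_comb_poly[of ?v R m K c p, OF Kc] p(3) by (simp add: K'_def c'_def[abs_def])
  \<comment> \<open>P will be non-zero because the leading coefficient of p contributes a non-zero
    coefficient, at a monomial with exponent \<open>degree p\<close> at m.\<close>
  have "lead_coeff p \<noteq> 0" using p by simp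
  moreover have "lead_coeff p = (\<Sum>k\<in>K (degree p). c (degree p) k * power_prod ?v m k)"
    and K0: "\<forall>k\<in>K (degree p). k m = 0"
    using Kc[of "degree p"] by (auto simp: power_prod_comb_def)
  ultimately obtain k where k: "k \<in> K (degree p)" "c (degree p) k \<noteq> 0"
    by (metis (mono_tags, lifting) mult_zero_left sum.neutral)
  define k' where "k' = k(m := degree p)"
  have "k'(m := 0) = k" using K0 k(1) by (auto simp: k'_def)
  then have k': "k' \<in> K'" "c' k' \<noteq> 0"
    using k by (auto simp: K'_def k'_def c'_def simp del: fun_upd_apply simp: fun_upd_same image_iff)
  have fin: "finite {j. k j \<noteq> 0}" if "k \<in> K'" for k
  proof (rule finite_subset[of _ "{..m}"])
    have "k j = 0" if "j \<ge> Suc m" for j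
      using comb \<open>k \<in> K'\<close> that by (auto simp: power_prod_comb_def)
    then show "{j. k j \<noteq> 0} \<subseteq> {..m}" by (metis (mono_tags, lifting) atMost_iff mem_Collect_eq not_less_eq_eq subsetI)
  qed auto
  have lookup_Abs: "Poly_Mapping.lookup (Abs_poly_mapping k) = k" if "k \<in> K'" for k
    using fin[OF that] by (simp add: Abs_poly_mapping_inverse)
  define P where "P = Abs_poly_mapping (\<lambda>\<kappa>. if Poly_Mapping.lookup \<kappa> \<in> K' then c' (Poly_Mapping.lookup \<kappa>) else 0)"
  have "{\<kappa> :: nat \<Rightarrow>\<^sub>0 nat. Poly_Mapping.lookup \<kappa> \<in> K'} \<subseteq> Abs_poly_mapping ` K'"
    by (metis (no_types, lifting) image_eqI lookup_inverse mem_Collect_eq subsetI)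
  moreover have finK': "finite K'" using comb by (simp add: power_prod_comb_def)
  ultimately have finS: "finite {\<kappa> :: nat \<Rightarrow>\<^sub>0 nat. Poly_Mapping.lookup \<kappa> \<in> K'}"
    using finite_surj by blast
  have lookup_P: "Poly_Mapping.lookup P \<kappa> = (if Poly_Mapping.lookup \<kappa> \<in> K' then c' (Poly_Mapping.lookup \<kappa>) else 0)" for \<kappa>
    unfolding P_def by (subst Abs_poly_mapping_inverse) (auto intro: finite_subset[OF _ finS])
  have keysP: "Poly_Mapping.keys P \<subseteq> {\<kappa>. Poly_Mapping.lookup \<kappa> \<in> K'}"
    by (auto simp: in_keys_iff lookup_P split: if_splits)
  have "diffpoly_eval \<delta> P y = (\<Sum>\<kappa>\<in>Poly_Mapping.keys P.
           Poly_Mapping.lookup P \<kappa> * power_prod ?v (Suc m) (Poly_Mapping.lookup \<kappa>))"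
  proof (rule diffpoly_eval_power_prod)
    fix \<kappa> assume "\<kappa> \<in> Poly_Mapping.keys P"
    then have "Poly_Mapping.lookup \<kappa> \<in> K'" using keysP by auto
    then have "\<forall>j\<ge>Suc m. Poly_Mapping.lookup \<kappa> j = 0" using comb by (auto simp: power_prod_comb_def)
    then show "Poly_Mapping.keys \<kappa> \<subseteq> {..<Suc m}"
      by (metis in_keys_iff lessThan_iff not_le subsetI)
  qed
  also have "\<dots> = (\<Sum>\<kappa>\<in>{\<kappa>. Poly_Mapping.lookup \<kappa> \<in> K'}.
           Poly_Mapping.lookup P \<kappa> * power_prod ?v (Suc m) (Poly_Mapping.lookup \<kappa>))"
    using finS keysP by (intro sum.mono_neutral_left) (auto simp: in_keys_iff)
  also have "\<dots> = (\<Sum>k\<in>K'. c' k * power_prod ?v (Suc m) k)"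
    by (rule sum.reindex_bij_witness[of _ Abs_poly_mapping Poly_Mapping.lookup])
       (auto simp: lookup_inverse lookup_Abs lookup_P)
  also have "\<dots> = 0" using comb by (simp add: power_prod_comb_def)
  finally have "diffpoly_eval \<delta> P y = 0" .
  moreover have "Poly_Mapping.lookup P (Abs_poly_mapping k') \<noteq> 0"
    using k' by (simp add: lookup_P lookup_Abs)
  then have "P \<noteq> 0" by auto
  moreover have "Poly_Mapping.lookup P \<kappa> \<in> R" for \<kappa>
    using comb R by (auto simp: lookup_P power_prod_comb_def intro: subring_zero)
  ultimately show "differentially_algebraic \<delta> R y" unfolding differentially_algebraic_def by blast
qed

section \<open>Finite transcendence degree of the derivatives\<close>

text \<open>Finite transcendence degree over C of the ring of all derivatives. X need not consist of
  derivatives of y nor be stable under \<delta>, which makes the notion easy to transport.\<close>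

definition finite_rank :: "'s::idom set \<Rightarrow> ('s \<Rightarrow> 's) \<Rightarrow> 's \<Rightarrow> bool" where
  "finite_rank C \<delta> y \<longleftrightarrow> (\<exists>X. finite X \<and> (\<forall>i. (\<delta> ^^ i) y \<in> alg_cl (C \<union> X)))"

text \<open>The closure is stable under \<delta>: a listed derivative is sent to the next one, and
  the last of them to an element that the given relation puts into the closure.\<close>

lemma finite_rank_relation:
  fixes \<delta> :: "'s::idom \<Rightarrow> 's"
  assumes "is_derivation \<delta>" "\<And>n. n > 0 \<Longrightarrow> of_nat n \<noteq> (0 :: 's)"
    and "\<delta> ` G \<subseteq> alg_cl (G \<union> (\<lambda>i. (\<delta> ^^ i) y) ` {..<m})"
    and "(\<delta> ^^ m) y \<in> alg_cl (G \<union> (\<lambda>i. (\<delta> ^^ i) y) ` {..<m})"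
  shows "(\<delta> ^^ i) y \<in> alg_cl (G \<union> (\<lambda>i. (\<delta> ^^ i) y) ` {..<m})"
proof -
  let ?v = "\<lambda>i. (\<delta> ^^ i) y" and ?H = "G \<union> (\<lambda>i. (\<delta> ^^ i) y) ` {..<m}"
  have v: "?v k \<in> alg_cl ?H" if "k \<le> m" for k
    using assms(4) that subset_alg_cl[of ?H] by (cases "k = m") auto
  have "\<delta> ` ?H \<subseteq> alg_cl ?H" using assms(3) v[of "Suc _"] by auto
  then show ?thesis using derivation_funpow_alg_cl[OF assms(1,2) _ v[of 0]] by auto
qed

text \<open>Makes the notion independent of R: R is algebraic over C and a finite set F, with
  closure stable under \<delta>, and F is absorbed into the finite set of
  \<open>finite_rank\<close>. It is applied with z or t as the only element of F.\<close>

lemma differentially_algebraic_iff_finite_rank: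
  fixes \<delta> :: "'s::idom \<Rightarrow> 's"
  assumes \<delta>: "is_derivation \<delta>" and char0: "\<And>n. n > 0 \<Longrightarrow> of_nat n \<noteq> (0 :: 's)"
    and R: "is_subring R" "C \<subseteq> R" "R \<subseteq> alg_cl (C \<union> F)"
    and F: "finite F" "\<delta> ` (C \<union> F) \<subseteq> alg_cl (C \<union> F)"
  shows "differentially_algebraic \<delta> R y \<longleftrightarrow> finite_rank C \<delta> y"
proof
  let ?v = "\<lambda>i. (\<delta> ^^ i) y"
  assume "differentially_algebraic \<delta> R y"
  then obtain m where m: "?v m \<in> alg_cl (R \<union> ?v ` {..<m})"
    using differentially_algebraic_iff_alg_cl[OF R(1)] by blast
  let ?H = "(C \<union> F) \<union> ?v ` {..<m}"
  have CF: "alg_cl (C \<union> F) \<subseteq> alg_cl ?H" by (intro alg_cl_mono) auto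
  moreover have "?v ` {..<m} \<subseteq> alg_cl ?H" using subset_alg_cl[of ?H] by auto
  ultimately have "alg_cl (R \<union> ?v ` {..<m}) \<subseteq> alg_cl ?H"
    using R(3) by (intro alg_cl_least) auto
  then have vm: "?v m \<in> alg_cl ?H" using m by blast
  have "?v i \<in> alg_cl ?H" for i
    by (rule finite_rank_relation[OF \<delta> char0 _ vm]) (use F(2) CF in auto)
  then show "finite_rank C \<delta> y"
    unfolding finite_rank_def using F(1)
    by (intro exI[of _ "F \<union> ?v ` {..<m}"]) (auto simp: Un_assoc)
next
  let ?v = "\<lambda>i. (\<delta> ^^ i) y"
  assume "finite_rank C \<delta> y"
  then obtain m where "?v m \<in> alg_cl (C \<union> ?v ` {..<m})"
    using alg_cl_finite_rank[of _ ?v C] unfolding finite_rank_def by blast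
  moreover have "alg_cl (C \<union> ?v ` {..<m}) \<subseteq> alg_cl (R \<union> ?v ` {..<m})"
    using R(2) by (intro alg_cl_mono) auto
  ultimately show "differentially_algebraic \<delta> R y"
    using differentially_algebraic_iff_alg_cl[OF R(1)] by blast
qed

text \<open>Apply \<open>\<tau>\<close> to a relation between the derivatives of \<open>y\<close>: Leibniz' rule turns it into a
  relation that is linear in the derivatives of \<open>h\<close>.\<close>

lemma finite_rank_from_linearization:
  fixes \<delta> :: "'s::idom \<Rightarrow> 's"
  assumes \<delta>: "is_derivation \<delta>" and \<tau>: "is_derivation \<tau>"
    and comm: "\<And>s. \<tau> (\<delta> s) = \<delta> (\<tau> s)"
    and char0: "\<And>n. n > 0 \<Longrightarrow> of_nat n \<noteq> (0 :: 's)"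
    and C: "\<And>c. c \<in> C \<Longrightarrow> \<delta> c = 0" "\<And>c. c \<in> C \<Longrightarrow> \<tau> c = 0"
    and y: "finite_rank C \<delta> y" "\<tau> y = h * \<delta> y" "\<delta> y \<noteq> 0"
  shows "finite_rank C \<delta> h"
proof -
  let ?v = "\<lambda>i. (\<delta> ^^ i) y" and ?w = "\<lambda>i. (\<delta> ^^ i) h"
  obtain m where m: "?v m \<in> alg_cl (C \<union> ?v ` {..<m})"
    using y(1) alg_cl_finite_rank[of _ ?v C] unfolding finite_rank_def by blast
  define G where "G = C \<union> ?v ` {..<m}"
  \<comment> \<open>Images under \<tau> of derivatives of y of order below m involve only
    derivatives of h of order below m.\<close>
  define H where "H = G \<union> ?w ` {..<m}"
  have GH: "alg_cl G \<subseteq> alg_cl H" by (intro alg_cl_mono) (auto simp: H_def)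
  have vG: "?v i \<in> alg_cl G" for i
    unfolding G_def by (rule finite_rank_relation[OF \<delta> char0 _ m]) (auto simp: C intro: alg_cl_intros)
  have wH: "?w i \<in> alg_cl H" if "i < m" for i
    using that subset_alg_cl[of H] by (auto simp: H_def)
  have \<tau>v: "\<tau> (?v i) = (\<Sum>k\<le>i. of_nat (i choose k) * (?w k * ?v (Suc (i - k))))" for i
  proof -
    have "\<tau> (?v i) = (\<delta> ^^ i) (\<tau> y)" by (induction i) (simp_all add: comm)
    then show ?thesis
      by (simp add: y(2) derivation_funpow_mult[OF \<delta>] funpow_swap1)
  qed
  have in_H: "of_nat (i choose k) * (?w k * ?v (Suc (i - k))) \<in> alg_cl H" if "k < m" for i k
    using wH[OF that] vG[of "Suc (i - k)"] GH by (intro alg_cl_intros) auto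
  have "\<tau> x \<in> alg_cl H" if x: "x \<in> G" for x
  proof (cases "x \<in> C")
    case True
    then show ?thesis using C by (simp add: alg_cl_intros)
  next
    case False
    then obtain i where "x = ?v i" "i < m" using x by (auto simp: G_def)
    then show ?thesis unfolding \<open>x = _\<close> \<tau>v by (intro alg_cl_intros(7) in_H) auto
  qed
  then have "\<tau> (?v m) \<in> alg_cl H"
    by (intro derivation_alg_cl[OF \<tau> char0 _ _ vG]) (auto simp: H_def)
  \<comment> \<open>The term k = m isolates the only occurrence of the m-th derivative of h; its
    coefficient \<open>\<delta> y\<close> is not 0.\<close>
  moreover have "\<tau> (?v m) = (\<Sum>k<m. of_nat (m choose k) * (?w k * ?v (Suc (m - k)))) + ?w m * \<delta> y"
    unfolding \<tau>v by (simp add: lessThan_Suc_atMost[symmetric])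
  moreover have "(\<Sum>k<m. of_nat (m choose k) * (?w k * ?v (Suc (m - k)))) \<in> alg_cl H"
    by (intro alg_cl_intros(7) in_H) auto
  ultimately have "\<delta> y * ?w m \<in> alg_cl H"
    using subring_diff[OF is_subring_alg_cl, of "\<tau> (?v m)" H] by (fastforce simp: mult.commute)
  moreover have "\<delta> y \<in> alg_cl H" using vG[of 1] GH by auto
  ultimately have "?w m \<in> alg_cl H" using alg_cl_divide y(3) by blast
  moreover have "\<delta> ` G \<subseteq> alg_cl H"
    using vG[of "Suc _"] GH by (auto simp: G_def C intro: alg_cl_intros)
  ultimately have "?w i \<in> alg_cl H" for i
    using finite_rank_relation[OF \<delta> char0] unfolding H_def by blast
  then show ?thesis
    unfolding finite_rank_def H_def G_def
    by (intro exI[of _ "?v ` {..<m} \<union> ?w ` {..<m}"]) (auto simp: Un_assoc)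
qed

section \<open>Transport along injective ring homomorphisms\<close>

definition is_inj_hom :: "('r::comm_ring_1 \<Rightarrow> 's::comm_ring_1) \<Rightarrow> bool" where
  "is_inj_hom \<sigma> \<longleftrightarrow> inj \<sigma> \<and> \<sigma> 1 = 1 \<and> (\<forall>a b. \<sigma> (a - b) = \<sigma> a - \<sigma> b) \<and> (\<forall>a b. \<sigma> (a * b) = \<sigma> a * \<sigma> b)"

lemma
  assumes "is_inj_hom \<sigma>"
  shows hom_inj: "inj \<sigma>" and hom_1: "\<sigma> 1 = 1" and hom_diff: "\<sigma> (a - b) = \<sigma> a - \<sigma> b"
    and hom_mult: "\<sigma> (a * b) = \<sigma> a * \<sigma> b"
  using assms by (auto simp: is_inj_hom_def)

lemma hom_0: "is_inj_hom \<sigma> \<Longrightarrow> \<sigma> 0 = 0"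
  using hom_diff[of \<sigma> 0 0] by simp

lemma hom_add: "is_inj_hom \<sigma> \<Longrightarrow> \<sigma> (a + b) = \<sigma> a + \<sigma> b"
  using hom_diff[of \<sigma> "a + b" b] by simp

lemma hom_eq_0_iff: "is_inj_hom \<sigma> \<Longrightarrow> \<sigma> a = 0 \<longleftrightarrow> a = 0"
  using hom_0[of \<sigma>] hom_inj[of \<sigma>] by (metis injD)

lemma hom_sum: "is_inj_hom \<sigma> \<Longrightarrow> \<sigma> (sum g I) = (\<Sum>i\<in>I. \<sigma> (g i))"
  by (induction I rule: infinite_finite_induct) (auto simp: hom_0 hom_add)

lemma hom_power: "is_inj_hom \<sigma> \<Longrightarrow> \<sigma> (a ^ n) = \<sigma> a ^ n"
  by (induction n) (auto simp: hom_1 hom_mult)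

lemma hom_prod: "is_inj_hom \<sigma> \<Longrightarrow> \<sigma> (prod g I) = (\<Prod>i\<in>I. \<sigma> (g i))"
  by (induction I rule: infinite_finite_induct) (auto simp: hom_1 hom_mult)

lemma alg_cl_hom:
  fixes \<sigma> :: "'r::idom \<Rightarrow> 's::idom"
  assumes \<sigma>: "is_inj_hom \<sigma>" and "x \<in> alg_cl G"
  shows "\<sigma> x \<in> alg_cl (\<sigma> ` G)"
proof -
  have gen: "\<sigma> a \<in> ring_gen (\<sigma> ` G)" if "a \<in> ring_gen G" for a
    using that
    by induction (auto simp: hom_1[OF \<sigma>] hom_diff[OF \<sigma>] hom_mult[OF \<sigma>] intro: ring_gen.intros)
  obtain p where p: "p \<noteq> 0" "\<And>i. coeff p i \<in> ring_gen G" "poly p x = 0"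
    using assms(2) by (auto simp: alg_cl_def algebraic_over_def)
  have "poly (map_poly \<sigma> p) (\<sigma> x) = \<sigma> (poly p x)"
    by (induction p) (simp_all add: hom_0[OF \<sigma>] hom_add[OF \<sigma>] hom_mult[OF \<sigma>] map_poly_pCons)
  moreover have "map_poly \<sigma> p \<noteq> 0"
    using p(1) hom_eq_0_iff[OF \<sigma>] by (simp add: map_poly_eq_0_iff hom_0[OF \<sigma>])
  ultimately show ?thesis
    using p gen hom_0[OF \<sigma>] unfolding alg_cl_def algebraic_over_def
    by (auto simp: coeff_map_poly intro!: exI[of _ "map_poly \<sigma> p"])
qed

lemma finite_rank_from_julia_equation:
  fixes \<delta> :: "'s::idom \<Rightarrow> 's"
  assumes \<delta>: "is_derivation \<delta>" and \<sigma>: "is_inj_hom \<sigma>"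
    and char0: "\<And>n. n > 0 \<Longrightarrow> of_nat n \<noteq> (0 :: 's)"
    and chain: "\<And>s. \<delta> (\<sigma> s) = \<sigma> (\<delta> s) * \<delta> y"
    and C: "\<And>c. c \<in> C \<Longrightarrow> \<delta> c = 0" "\<And>c. c \<in> C \<Longrightarrow> \<sigma> c = c"
    and h: "finite_rank C \<delta> h" "h \<noteq> 0" "h * \<delta> y = \<sigma> h"
  shows "finite_rank C \<delta> y"
proof -
  let ?w = "\<lambda>i. (\<delta> ^^ i) h"
  obtain X where X: "finite X" "\<And>i. ?w i \<in> alg_cl (C \<union> X)"
    using h(1) unfolding finite_rank_def by blast
  \<comment> \<open>All derivatives of h are taken, so that stability under \<delta> can be checked
    generator by generator; that this infinite set has finite rank over C is shown
    afterwards.\<close>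
  define G where "G = C \<union> range ?w \<union> range (\<lambda>i. \<sigma> (?w i)) \<union> {y}"
  have G: "C \<subseteq> alg_cl G" "?w i \<in> alg_cl G" "\<sigma> (?w i) \<in> alg_cl G" "y \<in> alg_cl G" for i
    using subset_alg_cl[of G] by (auto simp: G_def)
  have "h * \<delta> y \<in> alg_cl G" "h \<in> alg_cl G" using G(2,3)[of 0] h(3) by simp_all
  then have y': "\<delta> y \<in> alg_cl G" using alg_cl_divide h(2) by blast
  have "\<delta> (\<sigma> (?w i)) \<in> alg_cl G" for i
    using G(3)[of "Suc i"] y' by (simp add: chain alg_cl_intros)
  then have "\<delta> x \<in> alg_cl G" if "x \<in> G" for x
    using that G(2)[of "Suc _"] y' C(1) alg_cl_intros(4)[of G] unfolding G_def by auto
  then have "\<delta> ` G \<subseteq> alg_cl G" by blast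
  then have "(\<delta> ^^ i) y \<in> alg_cl G" for i by (intro derivation_funpow_alg_cl[OF \<delta> char0] G)
  moreover have "alg_cl G \<subseteq> alg_cl (C \<union> (X \<union> \<sigma> ` X \<union> {y}))" (is "_ \<subseteq> alg_cl ?H")
  proof (rule alg_cl_least)
    \<comment> \<open>As \<sigma> fixes C, it sends relations over C and X to relations over C and
      the image of X.\<close>
    have "alg_cl (C \<union> X) \<subseteq> alg_cl ?H" "alg_cl (\<sigma> ` (C \<union> X)) \<subseteq> alg_cl ?H" "?H \<subseteq> alg_cl ?H"
      using C(2) by (intro alg_cl_mono subset_alg_cl; auto)+
    then show "G \<subseteq> alg_cl ?H" using X(2) alg_cl_hom[OF \<sigma> X(2)] by (auto simp: G_def)
  qed
  ultimately show ?thesis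
    unfolding finite_rank_def using X(1) by (intro exI[of _ "X \<union> \<sigma> ` X \<union> {y}"]) auto
qed

text \<open>Used to move h from K[[z]] into K[t][[z]], where all three statements can be compared.
  Coefficients are pulled back along e, and injectivity preserves supports.\<close>

lemma differentially_algebraic_hom_iff:
  fixes e :: "'r::idom \<Rightarrow> 's::idom"
  assumes e: "is_inj_hom e" and comm: "\<And>a. e (\<delta> a) = \<delta>' (e a)"
  shows "differentially_algebraic \<delta>' (e ` R) (e y) \<longleftrightarrow> differentially_algebraic \<delta> R y"
proof -
  note e0 = hom_eq_0_iff[OF e]
  have pow: "e ((\<delta> ^^ i) y) = (\<delta>' ^^ i) (e y)" for i by (induction i) (simp_all add: comm)
  have eval: "diffpoly_eval \<delta>' Q (e y) = e (diffpoly_eval \<delta> P y)"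
    if "\<And>\<kappa>. Poly_Mapping.lookup Q \<kappa> = e (Poly_Mapping.lookup P \<kappa>)" for P Q
  proof -
    have "Poly_Mapping.keys Q = Poly_Mapping.keys P" by (auto simp: in_keys_iff that e0)
    then show ?thesis
      by (simp add: diffpoly_eval_def that hom_sum[OF e] hom_mult[OF e] hom_prod[OF e] hom_power[OF e] pow)
  qed
  show ?thesis
  proof
    assume "differentially_algebraic \<delta>' (e ` R) (e y)"
    then obtain Q :: "(nat \<Rightarrow>\<^sub>0 nat) \<Rightarrow>\<^sub>0 's" where Q: "Q \<noteq> 0"
      "\<And>\<kappa>. Poly_Mapping.lookup Q \<kappa> \<in> e ` R" "diffpoly_eval \<delta>' Q (e y) = 0"
      unfolding differentially_algebraic_def by blast
    from Q(2) obtain c where c: "\<And>\<kappa>. c \<kappa> \<in> R" "\<And>\<kappa>. Poly_Mapping.lookup Q \<kappa> = e (c \<kappa>)"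
      unfolding image_iff by metis
    have "finite {\<kappa>. Poly_Mapping.lookup Q \<kappa> \<noteq> 0}" by simp
    then have "finite {\<kappa>. c \<kappa> \<noteq> 0}" unfolding c(2) e0 .
    then have P: "Poly_Mapping.lookup (Abs_poly_mapping c) \<kappa> = c \<kappa>" for \<kappa>
      by (simp add: Abs_poly_mapping_inverse)
    have "e (diffpoly_eval \<delta> (Abs_poly_mapping c) y) = 0"
      using eval[of Q "Abs_poly_mapping c"] Q(3) by (simp add: c P)
    moreover have "Abs_poly_mapping c \<noteq> 0"
    proof
      assume "Abs_poly_mapping c = 0"
      then have "c \<kappa> = 0" for \<kappa> using P[of \<kappa>] by simp
      then show False using Q(1) c(2) e0 by (auto intro: poly_mapping_eqI)
    qed
    ultimately show "differentially_algebraic \<delta> R y"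
      unfolding differentially_algebraic_def using c(1) P e0 by metis
  next
    assume "differentially_algebraic \<delta> R y"
    then obtain P :: "(nat \<Rightarrow>\<^sub>0 nat) \<Rightarrow>\<^sub>0 'r" where P: "P \<noteq> 0"
      "\<And>\<kappa>. Poly_Mapping.lookup P \<kappa> \<in> R" "diffpoly_eval \<delta> P y = 0"
      unfolding differentially_algebraic_def by blast
    have Q: "Poly_Mapping.lookup (Poly_Mapping.map e P) \<kappa> = e (Poly_Mapping.lookup P \<kappa>)" for \<kappa>
      by (simp add: map.rep_eq when_def e0)
    have "Poly_Mapping.map e P \<noteq> 0"
    proof
      assume "Poly_Mapping.map e P = 0"
      then have "Poly_Mapping.lookup P \<kappa> = 0" for \<kappa> using Q[of \<kappa>] e0 by simp
      then show False using P(1) by (auto intro: poly_mapping_eqI)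
    qed
    moreover have "diffpoly_eval \<delta>' (Poly_Mapping.map e P) (e y) = 0"
      using eval[OF Q] P(3) e0 by simp
    ultimately show "differentially_algebraic \<delta>' (e ` R) (e y)"
      unfolding differentially_algebraic_def using P(2) Q by blast
  qed
qed

section \<open>Power series over \<open>K[t]\<close>\<close>

lemma is_derivation_fps_deriv: "is_derivation (fps_deriv :: 's::comm_ring_1 fps \<Rightarrow> _)"
  by (auto simp: is_derivation_def algebra_simps)

definition t_const :: "'a::idom fps \<Rightarrow> 'a poly fps" where
  "t_const g = Abs_fps (\<lambda>j. [:g $ j:])"

text \<open>Regards a series in K[t][[z]] as a power series in t over K[[z]], so that equations in t
  can be solved recursively.\<close>

definition t_coeff :: "nat \<Rightarrow> 'a::idom poly fps \<Rightarrow> 'a fps" where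
  "t_coeff n s = Abs_fps (\<lambda>j. coeff (s $ j) n)"

definition t_deriv :: "'a::idom poly fps \<Rightarrow> 'a poly fps" where
  "t_deriv s = Abs_fps (\<lambda>j. pderiv (s $ j))"

definition t_eval :: "nat \<Rightarrow> 'a::idom poly fps \<Rightarrow> 'a fps" where
  "t_eval n s = Abs_fps (\<lambda>j. poly (s $ j) (of_nat n))"

lemma t_const_nth [simp]: "t_const g $ j = [:g $ j:]"
  and t_coeff_nth [simp]: "t_coeff n s $ j = coeff (s $ j) n"
  and t_deriv_nth [simp]: "t_deriv s $ j = pderiv (s $ j)"
  and t_eval_nth [simp]: "t_eval n s $ j = poly (s $ j) (of_nat n)"
  by (simp_all add: t_const_def t_coeff_def t_deriv_def t_eval_def)

lemma t_coeff_ext: "(\<And>n. t_coeff n s = t_coeff n s') \<Longrightarrow> s = s'"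
  by (simp add: fps_eq_iff poly_eq_iff)

lemma sum_pCons_0: "(\<Sum>i\<in>I. [:g i:]) = [:\<Sum>i\<in>I. g i:]"
  by (induction I rule: infinite_finite_induct) auto

lemma is_inj_hom_t_const: "is_inj_hom t_const"
  unfolding is_inj_hom_def
proof (intro conjI allI)
  show "inj t_const" by (auto intro!: injI simp: fps_eq_iff)
  show "t_const 1 = 1" by (auto simp: fps_eq_iff)
  show "t_const (a - b) = t_const a - t_const b" for a b by (auto simp: fps_eq_iff)
  show "t_const (a * b) = t_const a * t_const b" for a b
    by (auto simp: fps_eq_iff fps_mult_nth sum_pCons_0 mult.commute)
qed

lemma t_const_deriv: "t_const (fps_deriv g) = fps_deriv (t_const g)"
  by (simp add: fps_eq_iff of_nat_poly flip: of_nat_Suc)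

lemma pderiv_sum: "pderiv (sum g I) = (\<Sum>i\<in>I. pderiv (g i :: 's::idom poly))"
  by (rule derivation_sum) (simp add: is_derivation_def pderiv_add pderiv_mult algebra_simps)

lemma is_derivation_t_deriv: "is_derivation t_deriv"
  unfolding is_derivation_def
proof (intro conjI allI)
  show "t_deriv (a + b) = t_deriv a + t_deriv b" for a b :: "'a poly fps"
    by (simp add: fps_eq_iff pderiv_add)
  show "t_deriv (a * b) = t_deriv a * b + a * t_deriv b" for a b :: "'a poly fps"
    unfolding fps_eq_iff fps_add_nth fps_mult_nth t_deriv_nth pderiv_sum pderiv_mult sum.distrib[symmetric]
    by (simp add: algebra_simps)
qed

lemma t_deriv_const: "t_deriv (t_const g) = 0"
  by (simp add: fps_eq_iff pderiv_pCons)

lemma t_deriv_deriv: "t_deriv (fps_deriv s) = fps_deriv (t_deriv s)"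
  by (simp add: fps_eq_iff pderiv_smult of_nat_poly flip: of_nat_Suc)

lemma t_coeff_const_mult: "t_coeff n (t_const g * s) = g * t_coeff n s"
  by (simp add: fps_eq_iff fps_mult_nth coeff_sum)

lemma t_coeff_deriv: "t_coeff n (fps_deriv s) = fps_deriv (t_coeff n s)"
  by (simp add: fps_eq_iff of_nat_poly flip: of_nat_Suc)

lemma t_coeff_t_deriv: "t_coeff n (t_deriv s) = fps_const (of_nat (Suc n)) * t_coeff (Suc n) s"
  by (simp add: fps_eq_iff coeff_pderiv)

lemma t_coeff_0_mult: "t_coeff 0 (a * b) = t_coeff 0 a * t_coeff 0 b"
  by (simp add: fps_eq_iff fps_mult_nth coeff_sum coeff_mult)

lemma t_coeff_1_mult: "t_coeff 1 (a * b) = t_coeff 0 a * t_coeff 1 b + t_coeff 1 a * t_coeff 0 b"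
  by (simp add: fps_eq_iff fps_mult_nth coeff_sum coeff_mult sum.distrib)

lemma t_coeff_0_power: "t_coeff 0 (a ^ n) = t_coeff 0 a ^ n"
  by (induction n) (simp_all add: t_coeff_0_mult, simp add: fps_eq_iff)

lemma t_coeff_0_compose: "t_coeff 0 (t_const g oo y) = g oo t_coeff 0 y"
proof (rule fps_ext)
  fix j
  have "coeff (y ^ i $ j) 0 = (t_coeff 0 y ^ i) $ j" for i
    by (simp flip: t_coeff_0_power)
  then show "t_coeff 0 (t_const g oo y) $ j = (g oo t_coeff 0 y) $ j"
    by (simp add: fps_compose_nth coeff_sum)
qed

lemma derivation_power:
  assumes "is_derivation \<delta>" shows "\<delta> (a ^ n) = of_nat n * a ^ (n - 1) * \<delta> a"
proof (induction n)
  case (Suc n)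
  then show ?case
    by (cases n) (simp_all add: derivation_1 derivation_mult assms algebra_simps)
qed (simp add: derivation_1 assms)

lemma smult_sum_right: "smult c (sum g I) = (\<Sum>i\<in>I. smult c (g i))"
  by (induction I rule: infinite_finite_induct) (auto simp: smult_add_right)

text \<open>Chain rule for d/dt, in this form because the outer series does not depend on t. The
  composite is an infinite sum, so the power rule for \<open>y ^ i\<close> is applied within each
  coefficient.\<close>

lemma t_deriv_compose:
  assumes y0: "y $ 0 = 0"
  shows "t_deriv (t_const g oo y) = (t_const (fps_deriv g) oo y) * t_deriv y"
proof (rule fps_ext)
  fix n
  have pd: "pderiv (y ^ i $ n) = (of_nat i * y ^ (i - 1) * t_deriv y) $ n" for i
    using derivation_power[OF is_derivation_t_deriv, of y i] by (metis t_deriv_nth)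
  have y'0: "t_deriv y $ 0 = 0" using y0 by simp
  have of_nat_nth: "(of_nat i * a) $ n = of_nat i * a $ n" for i and a :: "'a poly fps"
    by (simp flip: fps_of_nat)
  have "t_deriv (t_const g oo y) $ n = (\<Sum>i=0..n. smult (g $ i) (pderiv (y ^ i $ n)))"
    by (simp add: fps_compose_nth pderiv_sum pderiv_smult)
  also have "\<dots> = (\<Sum>i=0..n. smult (of_nat i * g $ i) ((y ^ (i - 1) * t_deriv y) $ n))"
    unfolding pd mult.assoc of_nat_nth by (intro sum.cong) (auto simp: of_nat_poly mult.commute)
  \<comment> \<open>The extra term vanishes because \<open>y ^ n\<close> has order at least n and
    \<open>t_deriv y\<close> has no constant term; it prepares the index shift.\<close>
  also have "\<dots> = (\<Sum>i=0..Suc n. smult (of_nat i * g $ i) ((y ^ (i - 1) * t_deriv y) $ n))"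
  proof -
    have "(y ^ n * t_deriv y) $ n = 0"
    proof -
      have "y ^ n $ i * t_deriv y $ (n - i) = 0" if "i \<le> n" for i
        using that y'0 startsby_zero_power_prefix[OF y0, of n] by (cases "i = n") auto
      then show ?thesis unfolding fps_mult_nth by (intro sum.neutral) auto
    qed
    then show ?thesis by simp
  qed
  also have "\<dots> = (\<Sum>i=0..n. smult (fps_deriv g $ i) ((y ^ i * t_deriv y) $ n))"
    by (subst sum.atLeast0_atMost_Suc_shift) simp
  also have "\<dots> = (\<Sum>i=0..n. \<Sum>k=0..n. smult (fps_deriv g $ i) (y ^ i $ k * t_deriv y $ (n - k)))"
    by (simp add: fps_mult_nth smult_sum_right)
  also have "\<dots> = (\<Sum>k=0..n. \<Sum>i=0..n. smult (fps_deriv g $ i) (y ^ i $ k * t_deriv y $ (n - k)))"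
    by (rule sum.swap)
  also have "\<dots> = (\<Sum>k=0..n. \<Sum>i=0..k. smult (fps_deriv g $ i) (y ^ i $ k * t_deriv y $ (n - k)))"
    using startsby_zero_power_prefix[OF y0]
    by (intro sum.cong sum.mono_neutral_right) (auto simp del: fps_deriv_nth t_deriv_nth)
  also have "\<dots> = ((t_const (fps_deriv g) oo y) * t_deriv y) $ n"
    by (simp add: fps_mult_nth[of "t_const (fps_deriv g) oo y"] fps_compose_nth sum_distrib_right
        del: fps_deriv_nth t_deriv_nth)
  finally show "t_deriv (t_const g oo y) $ n = ((t_const (fps_deriv g) oo y) * t_deriv y) $ n" .
qed

text \<open>K rather than K[t], so that d/dt vanishes on it as well as d/dz.\<close>

definition ground_consts :: "'a::idom poly fps set" where
  "ground_consts = range (\<lambda>c. fps_const [:c:])"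

section \<open>Rational algebras\<close>

locale rational_idom =
  fixes \<iota> :: "rat \<Rightarrow> 'a::idom"
  assumes rat_embedding: "rat_embedding \<iota>"
begin

lemma emb_1 [simp]: "\<iota> 1 = 1" and emb_add: "\<iota> (p + q) = \<iota> p + \<iota> q" and emb_mult: "\<iota> (p * q) = \<iota> p * \<iota> q"
  using rat_embedding by (auto simp: rat_embedding_def)

lemma emb_0 [simp]: "\<iota> 0 = 0"
  using emb_add[of 0 0] by (metis add_0 add_cancel_right_right)

lemma emb_uminus: "\<iota> (- p) = - \<iota> p"
  using emb_add[of p "- p"] by (simp add: eq_neg_iff_add_eq_0 add.commute)

lemma emb_of_nat: "\<iota> (of_nat n) = of_nat n"
  by (induction n) (simp_all add: emb_add)

lemma emb_eq_0_iff [simp]: "\<iota> p = 0 \<longleftrightarrow> p = 0"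
  using rat_embedding emb_0 by (metis injD rat_embedding_def)

lemma of_nat_eq_0: "of_nat n = (0 :: 'a) \<longleftrightarrow> n = 0"
  using emb_eq_0_iff[of "of_nat n"] by (simp add: emb_of_nat del: emb_eq_0_iff)

lemma inj_of_nat: "inj (of_nat :: nat \<Rightarrow> 'a)"
proof (rule injI)
  fix m n assume "of_nat m = (of_nat n :: 'a)"
  then have "of_nat (m - n) = (0 :: 'a)" "of_nat (n - m) = (0 :: 'a)"
    by (metis (no_types) diff_self of_nat_0 of_nat_diff_if)+
  then show "m = n" unfolding of_nat_eq_0 by simp
qed

text \<open>Each coefficient is a polynomial in t, and in characteristic 0 the natural numbers are
  infinitely many points.\<close>

lemma t_eval_ext:
  fixes s s' :: "'a poly fps"
  assumes "\<And>n. t_eval n s = t_eval n s'"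
  shows "s = s'"
proof (rule fps_ext)
  fix j
  have "range of_nat \<subseteq> {x. poly (s $ j - s' $ j) x = 0}"
    using assms by (auto simp: fps_eq_iff)
  moreover have "infinite (range (of_nat :: nat \<Rightarrow> 'a))"
    using inj_of_nat by (simp add: finite_image_iff)
  ultimately have "s $ j - s' $ j = 0"
    using poly_roots_finite finite_subset by blast
  then show "s $ j = s' $ j" by simp
qed

lemma of_nat_fps_eq_0: "n > 0 \<Longrightarrow> of_nat n \<noteq> (0 :: 'a poly fps)"
  using of_nat_eq_0[of n] by (simp add: of_nat_poly flip: fps_of_nat)

text \<open>\<open>flow h\<close> is \<open>exp (t h d/dz) z\<close>; the cut-off at \<open>n = j\<close> is harmless by \<open>lie_iterate_nth_eq_0\<close>.\<close>

definition lie_iterate :: "'a fps \<Rightarrow> nat \<Rightarrow> 'a fps" where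
  "lie_iterate h n = ((\<lambda>g. h * fps_deriv g) ^^ n) fps_X"

definition flow :: "'a fps \<Rightarrow> 'a poly fps" where
  "flow h = Abs_fps (\<lambda>j. \<Sum>n\<le>j. monom (\<iota> (1 / fact n) * lie_iterate h n $ j) n)"

context
  fixes h :: "'a fps"
  assumes h01: "h $ 0 = 0" "h $ 1 = 0"
begin

text \<open>h has order at least 2, so each application of h d/dz raises the order.\<close>

lemma lie_iterate_nth_eq_0: "j \<le> n \<Longrightarrow> lie_iterate h n $ j = 0"
proof (induction n arbitrary: j)
  case 0
  then show ?case by (simp add: lie_iterate_def)
next
  case (Suc n)
  have "h $ i * fps_deriv (lie_iterate h n) $ (j - i) = 0" if "i \<le> j" for i
  proof (cases "i \<le> 1")
    case True
    then show ?thesis using h01 by (auto simp: le_Suc_eq)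
  next
    case False
    then show ?thesis using Suc.prems that by (simp add: Suc.IH)
  qed
  then have "(h * fps_deriv (lie_iterate h n)) $ j = 0"
    unfolding fps_mult_nth by (intro sum.neutral) auto
  then show ?case by (simp add: lie_iterate_def)
qed

lemma t_coeff_flow: "t_coeff n (flow h) = fps_const (\<iota> (1 / fact n)) * lie_iterate h n"
  by (rule fps_ext) (simp add: flow_def coeff_sum lie_iterate_nth_eq_0)

lemma flow_0: "flow h $ 0 = 0"
  by (simp add: flow_def lie_iterate_nth_eq_0)

lemma deriv_flow_neq_0: "fps_deriv (flow h) \<noteq> 0"
proof
  assume "fps_deriv (flow h) = 0"
  moreover have "coeff (flow h $ 1) 0 = 1"
    using arg_cong[OF t_coeff_flow[of 0], of "\<lambda>s. s $ 1"] by (simp add: lie_iterate_def)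
  ultimately show False by (metis add_0 coeff_0 fps_deriv_nth fps_zero_nth mult.left_neutral of_nat_1 zero_neq_one)
qed

text \<open>Differentiating exp (t L) z in t, with L = h d/dz, brings down one L; on coefficients
  this is (n + 1) / (n + 1)! = 1 / n!.\<close>

lemma t_deriv_flow: "t_deriv (flow h) = t_const h * fps_deriv (flow h)"
proof (rule t_coeff_ext)
  fix n
  have "\<iota> (1 / fact n) = of_nat (Suc n) * \<iota> (1 / fact (Suc n))"
    unfolding emb_of_nat[symmetric] emb_mult[symmetric] by (simp del: of_nat_Suc)
  then have *: "fps_const (\<iota> (1 / fact n)) = fps_const (of_nat (Suc n)) * fps_const (\<iota> (1 / fact (Suc n)))"
    by (simp only: fps_const_mult)
  show "t_coeff n (t_deriv (flow h)) = t_coeff n (t_const h * fps_deriv (flow h))"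
    unfolding t_coeff_t_deriv t_coeff_const_mult t_coeff_deriv t_coeff_flow *
    by (simp add: lie_iterate_def algebra_simps del: fps_const_mult of_nat_Suc)
qed

text \<open>The coefficient of \<open>t ^ (n + 1)\<close> is determined by that of
  \<open>t ^ n\<close>, as n + 1 is non-zero in the domain K.\<close>

lemma transport_equation_unique:
  assumes "t_deriv w = t_const h * fps_deriv w" "t_deriv w' = t_const h * fps_deriv w'"
    and "t_coeff 0 w = t_coeff 0 w'"
  shows "w = w'"
proof (rule t_coeff_ext)
  fix n show "t_coeff n w = t_coeff n w'"
  proof (induction n)
    case (Suc n)
    have "fps_const (of_nat (Suc n)) * t_coeff (Suc n) w = fps_const (of_nat (Suc n)) * t_coeff (Suc n) w'"
      unfolding t_coeff_t_deriv[symmetric] assms t_coeff_const_mult t_coeff_deriv Suc ..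
    moreover have "fps_const (of_nat (Suc n)) \<noteq> (0 :: 'a fps)"
      using of_nat_eq_0[of "Suc n"] by (simp del: of_nat_Suc)
    ultimately show ?case by simp
  qed (use assms in simp)
qed

text \<open>Julia's equation. Both sides solve the transport equation, with the same value at \<open>t = 0\<close>.\<close>

lemma julia_equation: "t_const h * fps_deriv (flow h) = t_const h oo flow h"
proof (rule transport_equation_unique)
  show "t_deriv (t_const h * fps_deriv (flow h)) = t_const h * fps_deriv (t_const h * fps_deriv (flow h))"
    by (simp only: derivation_mult[OF is_derivation_t_deriv] t_deriv_const t_deriv_deriv t_deriv_flow
        mult_zero_left add_0)
  show "t_deriv (t_const h oo flow h) = t_const h * fps_deriv (t_const h oo flow h)"
    by (simp only: t_deriv_compose[OF flow_0] fps_compose_deriv[OF flow_0] t_deriv_flow t_const_deriv ac_simps)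
  show "t_coeff 0 (t_const h * fps_deriv (flow h)) = t_coeff 0 (t_const h oo flow h)"
    by (simp add: t_coeff_const_mult t_coeff_deriv t_coeff_0_compose t_coeff_flow lie_iterate_def)
qed

lemma finite_rank_iterate_iff:
  "finite_rank ground_consts fps_deriv (flow h) \<longleftrightarrow> finite_rank ground_consts fps_deriv (t_const h)"
proof
  assume y: "finite_rank ground_consts fps_deriv (flow h)"
  show "finite_rank ground_consts fps_deriv (t_const h)"
    by (rule finite_rank_from_linearization[OF is_derivation_fps_deriv is_derivation_t_deriv
          t_deriv_deriv of_nat_fps_eq_0 _ _ y t_deriv_flow deriv_flow_neq_0])
       (auto simp: ground_consts_def fps_eq_iff pderiv_pCons)
next
  assume h: "finite_rank ground_consts fps_deriv (t_const h)"
  show "finite_rank ground_consts fps_deriv (flow h)"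
  proof (cases "h = 0")
    case True
    have "lie_iterate h n = (if n = 0 then fps_X else 0)" for n
      by (cases n) (simp_all add: lie_iterate_def True)
    then have "t_coeff n (flow h) = t_coeff n fps_X" for n
      unfolding t_coeff_flow by (auto simp: fps_eq_iff fps_X_def)
    then have "flow h = fps_X" by (rule t_coeff_ext)
    have "(fps_deriv ^^ i) fps_X \<in> {fps_X, 1, 0 :: 'a poly fps}" for i
      by (induction i) auto
    then have "(fps_deriv ^^ i) (flow h) \<in> alg_cl (ground_consts \<union> {fps_X, 1, 0})" for i
      unfolding \<open>flow h = fps_X\<close> by (intro subsetD[OF subset_alg_cl]) blast
    then show ?thesis
      unfolding finite_rank_def by (intro exI[of _ "{fps_X, 1, 0}"] conjI allI) auto
  next
    case False
    have "flow h \<noteq> 0" using deriv_flow_neq_0 by auto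
    have "inj (\<lambda>s. s oo flow h)"
    proof (rule injI)
      fix a b assume "a oo flow h = b oo flow h"
      then have "(a - b) oo flow h = 0" by (simp add: fps_compose_sub_distrib)
      then show "a = b" using \<open>flow h \<noteq> 0\<close> by (simp add: fps_compose_eq_0_iff[OF flow_0])
    qed
    then have "is_inj_hom (\<lambda>s. s oo flow h)"
      by (simp add: is_inj_hom_def fps_compose_sub_distrib fps_compose_mult_distrib flow_0)
    then show ?thesis
    proof (rule finite_rank_from_julia_equation[OF is_derivation_fps_deriv _ of_nat_fps_eq_0])
      show "t_const h \<noteq> 0" using False by (simp add: hom_eq_0_iff is_inj_hom_t_const)
    qed (use h in \<open>auto simp: fps_compose_deriv flow_0 julia_equation ground_consts_def\<close>)
  qed
qed

end

end

section \<open>Independence of the base ring: K, K[z] and K[t]\<close>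

lemma fps_const_pCons: "fps_const (pCons (a :: 'a::idom) p) = fps_const [:a:] + fps_const [:0, 1:] * fps_const p"
  by simp

text \<open>Here F is {t}: elements of K[t] are polynomials in t over K, and d/dz kills t.\<close>

lemma consts_in_poly_fps_finite_rank_iff:
  assumes "rat_embedding (\<iota> :: rat \<Rightarrow> 'a::idom)"
  shows "differentially_algebraic fps_deriv consts_in_poly_fps (y :: 'a poly fps) \<longleftrightarrow>
    finite_rank ground_consts fps_deriv y"
proof -
  interpret rational_idom \<iota> by standard fact
  show ?thesis
  proof (rule differentially_algebraic_iff_finite_rank[OF is_derivation_fps_deriv of_nat_fps_eq_0])
    let ?G = "ground_consts \<union> {fps_const [:0, 1:]} :: 'a poly fps set"
    show "is_subring (consts_in_poly_fps :: 'a poly fps set)"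
      unfolding is_subring_def consts_in_poly_fps_def
      by (auto simp flip: fps_const_1_eq_1)
    show "ground_consts \<subseteq> (consts_in_poly_fps :: 'a poly fps set)"
      by (auto simp: ground_consts_def consts_in_poly_fps_def)
    have "fps_const p \<in> alg_cl ?G" for p :: "'a poly"
    proof (induction p)
      case (pCons a p)
      have "?G \<subseteq> alg_cl ?G" by (rule subset_alg_cl)
      then show ?case using pCons unfolding fps_const_pCons[of a p]
        by (intro alg_cl_intros) (auto simp: ground_consts_def)
    qed (auto intro: alg_cl_intros)
    then show "(consts_in_poly_fps :: 'a poly fps set) \<subseteq> alg_cl ?G"
      by (auto simp: consts_in_poly_fps_def)
    show "fps_deriv ` ?G \<subseteq> alg_cl ?G" by (auto simp: ground_consts_def alg_cl_intros)
  qed auto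
qed

lemma polys_in_poly_fps_eq: "polys_in_poly_fps = t_const ` polys_in_fps"
proof -
  have "t_const (fps_of_poly p) = fps_of_poly (map_poly (\<lambda>c. [:c:]) p)" for p :: "'a poly"
    by (simp add: fps_eq_iff coeff_map_poly)
  then show ?thesis by (auto simp: polys_in_poly_fps_def polys_in_fps_def image_image)
qed

text \<open>Here F is {z}, and z has derivative 1.\<close>

lemma polys_in_poly_fps_finite_rank_iff:
  assumes "rat_embedding (\<iota> :: rat \<Rightarrow> 'a::idom)"
  shows "differentially_algebraic fps_deriv polys_in_poly_fps (y :: 'a poly fps) \<longleftrightarrow>
    finite_rank ground_consts fps_deriv y"
proof -
  interpret rational_idom \<iota> by standard fact
  show ?thesis
  proof (rule differentially_algebraic_iff_finite_rank[OF is_derivation_fps_deriv of_nat_fps_eq_0])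
    let ?G = "ground_consts \<union> {fps_X} :: 'a poly fps set"
    note hom = is_inj_hom_t_const[where ?'a = 'a]
    have sub: "is_subring (range fps_of_poly :: 'a fps set)"
      unfolding is_subring_def
      by (auto simp flip: fps_of_poly_1 fps_of_poly_diff fps_of_poly_mult)
    show "is_subring (polys_in_poly_fps :: 'a poly fps set)"
      unfolding polys_in_poly_fps_eq polys_in_fps_def is_subring_def
      using subring_one[OF sub] subring_diff[OF sub] subring_mult[OF sub]
      by (auto simp flip: hom_1[OF hom] hom_diff[OF hom] hom_mult[OF hom])
    show "ground_consts \<subseteq> (polys_in_poly_fps :: 'a poly fps set)"
    proof
      fix x :: "'a poly fps" assume "x \<in> ground_consts"
      then obtain c where "x = fps_const [:c:]" by (auto simp: ground_consts_def)
      also have "\<dots> = fps_of_poly (map_poly (\<lambda>c. [:c:]) [:c:])"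
        by (auto simp: fps_eq_iff coeff_map_poly coeff_pCons split: nat.split)
      finally show "x \<in> polys_in_poly_fps" by (auto simp: polys_in_poly_fps_def)
    qed
    have "fps_of_poly (map_poly (\<lambda>c. [:c:]) p) \<in> alg_cl ?G" for p :: "'a poly"
    proof (induction p)
      case (pCons a p)
      have "?G \<subseteq> alg_cl ?G" by (rule subset_alg_cl)
      then show ?case using pCons
        by (auto simp: map_poly_pCons fps_of_poly_pCons ground_consts_def intro!: alg_cl_intros)
    qed (auto intro: alg_cl_intros)
    then show "(polys_in_poly_fps :: 'a poly fps set) \<subseteq> alg_cl ?G"
      by (auto simp: polys_in_poly_fps_def)
    show "fps_deriv ` ?G \<subseteq> alg_cl ?G" by (auto simp: ground_consts_def alg_cl_intros)
  qed auto
qed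

section \<open>The matrices of triangular operators\<close>

text \<open>Packs linearity, continuity and upper triangularity into one condition; the series
  T(z^k) is row k of the matrix of T.\<close>

definition triangular :: "('a::idom fps \<Rightarrow> 'a fps) \<Rightarrow> bool" where
  "triangular T \<longleftrightarrow> (\<forall>g j. T g $ j = (\<Sum>k\<le>j. g $ k * T (fps_X ^ k) $ j))"

lemma triangular_nth: "triangular T \<Longrightarrow> T g $ j = (\<Sum>k\<le>j. g $ k * T (fps_X ^ k) $ j)"
  unfolding triangular_def by blast

lemma triangular_nth_below:
  assumes "triangular T" "j < i" shows "T (fps_X ^ i) $ j = 0"
  using assms(2) by (subst triangular_nth[OF assms(1)]) (auto intro!: sum.neutral simp: fps_X_power_nth)

lemma triangular_comp:
  assumes T: "triangular T" and U: "triangular U" shows "triangular (\<lambda>g. T (U g))"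
  unfolding triangular_def
proof (intro allI)
  fix g j
  have "T (U g) $ j = (\<Sum>k\<le>j. (\<Sum>l\<le>k. g $ l * U (fps_X ^ l) $ k) * T (fps_X ^ k) $ j)"
    by (subst triangular_nth[OF T], subst triangular_nth[OF U]) simp
  also have "\<dots> = (\<Sum>k\<le>j. (\<Sum>l\<le>j. g $ l * U (fps_X ^ l) $ k) * T (fps_X ^ k) $ j)"
    by (intro sum.cong refl arg_cong2[of _ _ _ _ "(*)"] sum.mono_neutral_left)
       (auto simp: triangular_nth_below[OF U])
  also have "\<dots> = (\<Sum>l\<le>j. g $ l * (\<Sum>k\<le>j. U (fps_X ^ l) $ k * T (fps_X ^ k) $ j))"
    by (simp add: sum_distrib_left sum_distrib_right mult.assoc) (rule sum.swap)
  also have "\<dots> = (\<Sum>l\<le>j. g $ l * T (U (fps_X ^ l)) $ j)"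
    by (simp flip: triangular_nth[OF T])
  finally show "T (U g) $ j = (\<Sum>l\<le>j. g $ l * T (U (fps_X ^ l)) $ j)" .
qed

lemma triangular_id: "triangular (\<lambda>g. g)"
  by (auto simp: triangular_def fps_X_power_nth if_distrib cong: if_cong)

lemma triangular_funpow: "triangular T \<Longrightarrow> triangular (T ^^ n)"
proof (induction n)
  case 0
  then show ?case using triangular_id by (simp add: id_def)
next
  case (Suc n)
  then show ?case using triangular_comp[of T "T ^^ n"] by (simp add: o_def)
qed

lemma triangular_compose: "triangular (\<lambda>g. g oo f)" if "f $ 0 = 0"
  by (simp add: triangular_def that fps_compose_nth atLeast0AtMost flip: fps_compose_power)

lemma triangular_diff:
  assumes "triangular T" "triangular U" shows "triangular (\<lambda>g. T g - U g)"
  unfolding triangular_def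
proof (intro allI)
  fix g j
  have "T g $ j - U g $ j = (\<Sum>k\<le>j. g $ k * T (fps_X ^ k) $ j) - (\<Sum>k\<le>j. g $ k * U (fps_X ^ k) $ j)"
    using triangular_nth[OF assms(1), of g j] triangular_nth[OF assms(2), of g j] by argo
  then show "(T g - U g) $ j = (\<Sum>k\<le>j. g $ k * (T (fps_X ^ k) - U (fps_X ^ k)) $ j)"
    by (simp add: sum_subtractf right_diff_distrib)
qed

text \<open>Row i of the matrix of h d/dz, without weights. For i = j + 1 the entry would be i times
  \<open>h $ 0\<close>, hence the assumption.\<close>

lemma of_nat_X_power_mult_nth:
  fixes h :: "'a::idom fps"
  assumes "h $ 0 = 0"
  shows "(of_nat i * fps_X ^ (i - 1) * h) $ j = (if i \<le> j then of_nat i * h $ (j - i + 1) else 0)"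
proof (cases i)
  case (Suc l)
  have "(of_nat i * fps_X ^ (i - 1) * h) $ j = of_nat i * (fps_X ^ l * h) $ j"
    unfolding Suc fps_of_nat[symmetric] by (simp add: mult.assoc del: of_nat_Suc)
  also have "\<dots> = (if i \<le> j then of_nat i * h $ (j - i + 1) else 0)"
  proof (cases "i \<le> j")
    case True
    then show ?thesis using Suc by (simp add: fps_X_power_mult_nth Suc_diff_Suc)
  next
    case False
    then have "j - l = 0" using Suc by simp
    then show ?thesis using False assms by (simp add: fps_X_power_mult_nth)
  qed
  finally show ?thesis .
qed simp

lemma lie_derivative_X_power_nth:
  fixes h :: "'a::idom fps"
  assumes "h $ 0 = 0"
  shows "(h * fps_deriv (fps_X ^ i)) $ j = (if i \<le> j then of_nat i * h $ (j - i + 1) else 0)"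
proof -
  have "h * fps_deriv (fps_X ^ i) = of_nat i * fps_X ^ (i - 1) * h"
    unfolding derivation_power[OF is_derivation_fps_deriv] by simp
  then show ?thesis by (simp only: of_nat_X_power_mult_nth[OF assms])
qed

lemma triangular_lie_derivative:
  assumes "h $ 0 = 0"
  shows "triangular (\<lambda>g. h * fps_deriv g)"
  unfolding triangular_def
proof (intro allI)
  fix g j
  have "(h * fps_deriv g) $ j = (\<Sum>i=0..j. fps_deriv g $ i * h $ (j - i))"
    by (simp add: mult.commute[of h] fps_mult_nth)
  also have "\<dots> = (\<Sum>k=0..Suc j. of_nat k * g $ k * h $ (Suc j - k))"
    by (subst sum.atLeast0_atMost_Suc_shift) simp
  \<comment> \<open>The term k = Suc j carries the factor \<open>h $ 0\<close> and
    disappears.\<close>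
  also have "\<dots> = (\<Sum>k\<le>j. g $ k * (h * fps_deriv (fps_X ^ k)) $ j)"
    using assms by (simp add: lie_derivative_X_power_nth[OF assms] atLeast0AtMost Suc_diff_le mult_ac)
  finally show "(h * fps_deriv g) $ j = (\<Sum>k\<le>j. g $ k * (h * fps_deriv (fps_X ^ k)) $ j)" .
qed

context rational_idom
begin

text \<open>Row i of M holds the coefficients of T(z^i), so matrix products are composites of
  operators; the weights \<open>\<Omega> i / \<Omega> k\<close> telescope, being a conjugation by a
  diagonal matrix.\<close>

lemma mat_pow_operator:
  assumes T: "triangular T" and \<Omega>: "reference_sequence \<Omega>"
    and M: "\<And>i j. M i j = \<iota> (\<Omega> i / \<Omega> j) * T (fps_X ^ i) $ j"
  shows "mat_pow M n i j = \<iota> (\<Omega> i / \<Omega> j) * (T ^^ n) (fps_X ^ i) $ j"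
proof (induction n arbitrary: i)
  case 0
  show ?case using \<Omega> by (auto simp: mat_one_def fps_X_power_nth reference_sequence_def)
next
  case (Suc n)
  have "\<iota> (\<Omega> i / \<Omega> k) * \<iota> (\<Omega> k / \<Omega> j) = \<iota> (\<Omega> i / \<Omega> j)" for k
    using \<Omega> by (simp add: reference_sequence_def flip: emb_mult)
  then have eq: "(\<iota> (\<Omega> i / \<Omega> k) * a) * (\<iota> (\<Omega> k / \<Omega> j) * b) = \<iota> (\<Omega> i / \<Omega> j) * (a * b)" for k a b
    by (metis mult.assoc mult.left_commute)
  have "mat_pow M (Suc n) i j =
      (\<Sum>k\<le>j. (\<iota> (\<Omega> i / \<Omega> k) * T (fps_X ^ i) $ k) * (\<iota> (\<Omega> k / \<Omega> j) * (T ^^ n) (fps_X ^ k) $ j))"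
    by (simp add: mat_mult_def Suc M)
  also have "\<dots> = \<iota> (\<Omega> i / \<Omega> j) * (\<Sum>k\<le>j. T (fps_X ^ i) $ k * (T ^^ n) (fps_X ^ k) $ j)"
    by (simp only: eq sum_distrib_left)
  also have "(\<Sum>k\<le>j. T (fps_X ^ i) $ k * (T ^^ n) (fps_X ^ k) $ j) = (T ^^ n) (T (fps_X ^ i)) $ j"
    by (rule triangular_nth[symmetric]) (rule triangular_funpow[OF T])
  finally show ?case by (simp add: funpow_swap1)
qed

lemma mat_pow_inf_iter_mat:
  assumes \<Omega>: "reference_sequence \<Omega>" and h0: "h $ 0 = 0"
  shows "mat_pow (inf_iter_mat \<iota> \<Omega> h) n 1 j = \<iota> (1 / \<Omega> j) * lie_iterate h n $ j"
proof -
  have "inf_iter_mat \<iota> \<Omega> h i j = \<iota> (\<Omega> i / \<Omega> j) * (h * fps_deriv (fps_X ^ i)) $ j" for i j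
    by (simp add: inf_iter_mat_def lie_derivative_X_power_nth[OF h0] mult.assoc)
  from mat_pow_operator[OF triangular_lie_derivative[OF h0] \<Omega> this, of n 1 j]
  show ?thesis using \<Omega> by (simp add: lie_iterate_def reference_sequence_def)
qed

lemma mat_pow_t_mult:
  "mat_pow (\<lambda>i k. [:0, 1:] * [:M i k:]) n i j = monom (mat_pow M n i j) n"
proof (induction n arbitrary: i)
  case 0
  show ?case by (simp add: mat_one_def monom_0 flip: pCons_one)
next
  case (Suc n)
  have "[:0, 1:] * [:M i k:] = monom (M i k) 1" for k
    by (simp add: monom_Suc monom_0)
  then show ?case
    unfolding mat_pow.simps mat_mult_def Suc by (simp only: mult_monom monom_sum plus_1_eq_Suc)
qed

text \<open>Row 1 of the exponential lists the coefficients of exp (t h d/dz) z up to the weights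
  \<open>1 / \<Omega> j\<close>, which the final factor cancels.\<close>

lemma frac_iter_eq_flow:
  assumes \<Omega>: "reference_sequence \<Omega>" and "itlog \<iota> \<Omega> f = h" "h $ 0 = 0" "h $ 1 = 0"
  shows "frac_iter \<iota> \<Omega> f = flow h"
proof (rule fps_ext)
  fix j
  have inv: "\<iota> (1 / \<Omega> j) * \<iota> (\<Omega> j) = 1"
    using \<Omega> by (simp add: reference_sequence_def flip: emb_mult)
  show "frac_iter \<iota> \<Omega> f $ j = flow h $ j"
  proof (cases "j = 0")
    case True
    then show ?thesis using flow_0[OF assms(3,4)] by (simp add: frac_iter_def)
  next
    case False
    have "[:\<iota> (1 / fact n):] * monom (\<iota> (1 / \<Omega> j) * u) n * [:\<iota> (\<Omega> j):] = monom (\<iota> (1 / fact n) * u) n" for n u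
    proof -
      have "\<iota> (1 / fact n) * (\<iota> (1 / \<Omega> j) * u) * \<iota> (\<Omega> j) = (\<iota> (1 / \<Omega> j) * \<iota> (\<Omega> j)) * (\<iota> (1 / fact n) * u)"
        by (simp only: mult_ac)
      then show ?thesis unfolding inv monom_0[symmetric] mult_monom by simp
    qed
    then show ?thesis
      unfolding frac_iter_def assms(2) mat_exp_def mat_pow_t_mult mat_pow_inf_iter_mat[OF \<Omega> assms(3)]
      using False by (simp only: fps_nth_Abs_fps if_False sum_distrib_right flow_def)
  qed
qed

section \<open>Existence of the iterative logarithm\<close>

text \<open>The binomial coefficient (t choose k) as a polynomial in t; division by k + 1 goes
  through \<iota>.\<close>

fun binom_poly :: "nat \<Rightarrow> 'a poly" where
  "binom_poly 0 = 1"
| "binom_poly (Suc k) = smult (\<iota> (1 / of_nat (Suc k))) ([:- of_nat k, 1:] * binom_poly k)"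

lemma emb_inverse_of_nat: "\<iota> (1 / of_nat (Suc k)) * of_nat (Suc k) = 1"
  by (simp del: of_nat_Suc flip: emb_of_nat emb_mult)

lemma poly_binom_poly: "poly (binom_poly k) (of_nat n) = of_nat (n choose k)"
proof (induction k)
  case (Suc k)
  have "(of_nat n - of_nat k) * of_nat (n choose k) = (of_nat (Suc k) * of_nat (n choose Suc k) :: 'a)"
  proof (cases "k \<le> n")
    case True
    have "(n - k) * (n choose k) = Suc k * (n choose Suc k)"
      using binomial_absorb_comp[of n k] binomial_absorption[of k n] by simp
    then have "(of_nat ((n - k) * (n choose k)) :: 'a) = of_nat (Suc k * (n choose Suc k))" by simp
    with True show ?thesis by (simp only: of_nat_mult of_nat_diff)
  next
    case False
    then show ?thesis by (simp add: binomial_eq_0)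
  qed
  moreover have "poly (binom_poly (Suc k)) (of_nat n) =
      \<iota> (1 / of_nat (Suc k)) * ((of_nat n - of_nat k) * of_nat (n choose k))"
    by (simp add: Suc algebra_simps del: of_nat_Suc)
  ultimately have "poly (binom_poly (Suc k)) (of_nat n) =
      (\<iota> (1 / of_nat (Suc k)) * of_nat (Suc k)) * of_nat (n choose Suc k)"
    by (simp only: mult.assoc)
  then show ?case unfolding emb_inverse_of_nat by simp
qed simp

lemma coeff_binom_poly_0: "coeff (binom_poly k) 0 = (if k = 0 then 1 else 0)"
  by (induction k) auto

text \<open>These are the coefficients of log (1 + x), the derivative of (1 + x)^t at t = 0; this
  ties the interpolation to \<open>mat_log\<close>.\<close>

lemma coeff_binom_poly_1: "coeff (binom_poly k) 1 = (if k = 0 then 0 else \<iota> ((-1) ^ (k + 1) / of_nat k))"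
proof (induction k)
  case (Suc k)
  show ?case
  proof (cases "k = 0")
    case True
    then show ?thesis by simp
  next
    case False
    have "coeff (binom_poly (Suc k)) 1 = \<iota> (1 / of_nat (Suc k)) * (- of_nat k * \<iota> ((-1) ^ (k + 1) / of_nat k))"
      using Suc False by (simp add: coeff_binom_poly_0)
    also have "\<dots> = \<iota> (1 / of_nat (Suc k) * (- of_nat k * ((-1) ^ (k + 1) / of_nat k)))"
      by (simp only: emb_mult emb_uminus emb_of_nat)
    also have "1 / of_nat (Suc k) * (- of_nat k * ((-1) ^ (k + 1) / of_nat k)) = (-1) ^ (Suc k + 1) / (of_nat (Suc k) :: rat)"
      using False by (simp add: field_simps)
    finally show ?thesis by simp
  qed
qed simp

context
  fixes f :: "'a fps"
  assumes f01: "f $ 0 = 0" "f $ 1 = 1"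
begin

text \<open>The operator whose matrix is \<open>[f] - 1\<close>.\<close>

definition shift_diff :: "'a fps \<Rightarrow> 'a fps" where
  "shift_diff g = (g oo f) - g"

lemma triangular_shift_diff: "triangular shift_diff"
  unfolding shift_diff_def[abs_def] by (rule triangular_diff[OF triangular_compose[OF f01(1)] triangular_id])

text \<open>As f = z + ..., the lowest term of g cancels in \<open>(g oo f) - g\<close>, so each
  application raises the order.\<close>

lemma shift_diff_funpow_nth_eq_0: "j < k \<Longrightarrow> (shift_diff ^^ k) g $ j = 0"
proof (induction k arbitrary: j)
  case (Suc k)
  let ?u = "(shift_diff ^^ k) g"
  have "(?u oo f) $ j = (\<Sum>i\<in>{j}. ?u $ i * f ^ i $ j)"
    unfolding fps_compose_nth using Suc by (intro sum.mono_neutral_right) auto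
  also have "\<dots> = ?u $ j" using f01(2) by (simp add: startsby_zero_power_nth_same[OF f01(1)])
  finally show ?case by (simp add: shift_diff_def[of ?u])
qed simp

text \<open>The binomial theorem for the operator 1 + \<open>shift_diff\<close>.\<close>

lemma compose_funpow: "((\<lambda>g. g oo f) ^^ n) g = (\<Sum>k\<le>n. of_nat (n choose k) * (shift_diff ^^ k) g)"
proof (induction n arbitrary: g)
  case (Suc n)
  let ?F = "\<lambda>g. g oo f"
  have add: "(?F ^^ n) (a + b) = (?F ^^ n) a + (?F ^^ n) b" for a b
    by (induction n) (simp_all add: fps_compose_add_distrib)
  have "(?F ^^ Suc n) g = (?F ^^ n) (g + shift_diff g)"
    by (simp add: funpow_Suc_right shift_diff_def del: funpow.simps)
  also have "\<dots> = (\<Sum>k\<le>Suc n. of_nat (n choose k) * (shift_diff ^^ k) g) +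
      (\<Sum>k\<le>n. of_nat (n choose k) * (shift_diff ^^ Suc k) g)"
    unfolding add unfolding Suc by (simp add: binomial_eq_0 funpow_swap1)
  also have "(\<Sum>k\<le>Suc n. of_nat (n choose k) * (shift_diff ^^ k) g) =
      g + (\<Sum>k\<le>n. of_nat (n choose Suc k) * (shift_diff ^^ Suc k) g)"
    by (subst sum.atMost_Suc_shift) simp
  also have "\<dots> + (\<Sum>k\<le>n. of_nat (n choose k) * (shift_diff ^^ Suc k) g) =
      g + (\<Sum>k\<le>n. of_nat (Suc n choose Suc k) * (shift_diff ^^ Suc k) g)"
    by (simp add: algebra_simps sum.distrib)
  also have "\<dots> = (\<Sum>k\<le>Suc n. of_nat (Suc n choose k) * (shift_diff ^^ k) g)"
    by (subst (1) sum.atMost_Suc_shift) simp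
  finally show ?case .
qed simp

text \<open>The binomial series \<open>\<Sum>\<^sub>k (t choose k) \<Delta>\<^sup>k g\<close>, which interpolates the composites of \<open>g\<close> with the
  iterates of \<open>f\<close>; so it is multiplicative in \<open>g\<close>, and its coefficient at \<open>t\<close> is a derivation.\<close>

definition interpolation :: "'a fps \<Rightarrow> 'a poly fps" where
  "interpolation g = Abs_fps (\<lambda>j. \<Sum>k\<le>j. smult ((shift_diff ^^ k) g $ j) (binom_poly k))"

lemma t_eval_interpolation: "t_eval n (interpolation g) = ((\<lambda>g. g oo f) ^^ n) g"
proof (rule fps_ext)
  fix j
  have "((\<lambda>g. g oo f) ^^ n) g $ j = (\<Sum>k\<le>n. of_nat (n choose k) * (shift_diff ^^ k) g $ j)"
    unfolding compose_funpow by (simp add: fps_sum_nth flip: fps_of_nat)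
  \<comment> \<open>Beyond n the binomial coefficients vanish, beyond j the differences;
    \<open>n + j\<close> bounds both ranges.\<close>
  also have "\<dots> = (\<Sum>k\<le>n + j. of_nat (n choose k) * (shift_diff ^^ k) g $ j)"
    by (intro sum.mono_neutral_left) (auto simp: binomial_eq_0)
  also have "\<dots> = (\<Sum>k\<le>j. of_nat (n choose k) * (shift_diff ^^ k) g $ j)"
    by (intro sum.mono_neutral_right) (auto simp: shift_diff_funpow_nth_eq_0)
  also have "\<dots> = t_eval n (interpolation g) $ j"
    by (simp add: interpolation_def poly_sum poly_binom_poly mult.commute)
  finally show "t_eval n (interpolation g) $ j = ((\<lambda>g. g oo f) ^^ n) g $ j" ..
qed

lemma interpolation_mult: "interpolation (a * b) = interpolation a * interpolation b"
proof (rule t_eval_ext)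
  fix n
  have "((\<lambda>g. g oo f) ^^ n) (a * b) = ((\<lambda>g. g oo f) ^^ n) a * ((\<lambda>g. g oo f) ^^ n) b"
    by (induction n) (simp_all add: fps_compose_mult_distrib f01)
  moreover have "t_eval n (s * s') = t_eval n s * t_eval n s'" for s s' :: "'a poly fps"
    by (simp add: fps_eq_iff fps_mult_nth poly_sum)
  ultimately show "t_eval n (interpolation (a * b)) = t_eval n (interpolation a * interpolation b)"
    by (simp add: t_eval_interpolation)
qed

lemma t_coeff_0_interpolation: "t_coeff 0 (interpolation g) = g"
  by (rule fps_ext) (simp add: interpolation_def coeff_sum coeff_binom_poly_0 if_distrib cong: if_cong)

text \<open>log (1 + \<Delta>) for \<Delta> = \<open>shift_diff\<close>, obtained as the coefficient
  of t in (1 + \<Delta>)^t.\<close>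

definition log_compose :: "'a fps \<Rightarrow> 'a fps" where
  "log_compose g = t_coeff 1 (interpolation g)"

lemma log_compose_nth:
  "log_compose g $ j = (\<Sum>n=1..j. \<iota> ((-1) ^ (n + 1) / of_nat n) * (shift_diff ^^ n) g $ j)"
proof -
  have "log_compose g $ j = (\<Sum>n\<le>j. (shift_diff ^^ n) g $ j * coeff (binom_poly n) 1)"
    by (simp add: log_compose_def interpolation_def coeff_sum)
  also have "\<dots> = (\<Sum>n=1..j. (shift_diff ^^ n) g $ j * coeff (binom_poly n) 1)"
    unfolding coeff_binom_poly_1 by (intro sum.mono_neutral_right) auto
  also have "\<dots> = (\<Sum>n=1..j. \<iota> ((-1) ^ (n + 1) / of_nat n) * (shift_diff ^^ n) g $ j)"
    unfolding coeff_binom_poly_1 by (intro sum.cong refl) auto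
  finally show ?thesis .
qed

lemma log_compose_mult: "log_compose (a * b) = a * log_compose b + log_compose a * b"
  unfolding log_compose_def interpolation_mult t_coeff_1_mult t_coeff_0_interpolation ..

text \<open>Leibniz' rule determines a derivation on the powers of z by its value at z: here it acts
  as h d/dz with h = \<open>log_compose fps_X\<close>.\<close>

lemma log_compose_X_power: "log_compose (fps_X ^ i) = of_nat i * fps_X ^ (i - 1) * log_compose fps_X"
proof (induction i)
  case 0
  have "log_compose 1 = 0" using log_compose_mult[of 1 1] by (metis add_cancel_right_right mult.right_neutral mult_1)
  then show ?case by simp
next
  case (Suc i)
  then show ?case by (cases i) (simp_all add: log_compose_mult algebra_simps)
qed

text \<open>Existence of the iterative logarithm: the logarithm of the composition operator acts on
  powers of z as h d/dz, and \<open>inf_iter_mat\<close> is the weighted matrix of such an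
  operator.\<close>

lemma mat_log_iter_mat:
  assumes \<Omega>: "reference_sequence \<Omega>"
  shows "mat_log \<iota> (iter_mat \<iota> \<Omega> f) = inf_iter_mat \<iota> \<Omega> (log_compose fps_X)"
proof (intro ext)
  fix i j
  let ?h = "log_compose fps_X"
  have "iter_mat \<iota> \<Omega> f i j - mat_one i j = \<iota> (\<Omega> i / \<Omega> j) * shift_diff (fps_X ^ i) $ j" for i j
  proof -
    have "shift_diff (fps_X ^ i) = f ^ i - fps_X ^ i"
      by (simp add: shift_diff_def f01 fps_compose_power[OF f01(1), of fps_X i, symmetric])
    then show ?thesis using \<Omega>
      by (auto simp: iter_mat_def mat_one_def fps_X_power_nth reference_sequence_def right_diff_distrib)
  qed
  note mat_pow_operator[OF triangular_shift_diff \<Omega> this]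
  then have "mat_log \<iota> (iter_mat \<iota> \<Omega> f) i j = \<iota> (\<Omega> i / \<Omega> j) * log_compose (fps_X ^ i) $ j"
    by (simp add: mat_log_def log_compose_nth sum_distrib_left mult_ac)
  also have "log_compose (fps_X ^ i) $ j = (if i \<le> j then of_nat i * ?h $ (j - i + 1) else 0)"
    unfolding log_compose_X_power by (rule of_nat_X_power_mult_nth) (simp add: log_compose_nth)
  finally show "mat_log \<iota> (iter_mat \<iota> \<Omega> f) i j = inf_iter_mat \<iota> \<Omega> ?h i j"
    by (auto simp: inf_iter_mat_def)
qed

text \<open>Resolves the definite description. Order at least 2 is all that the analysis of
  \<open>flow h\<close> asks of h.\<close>

lemma itlog_low_coeffs:
  assumes \<Omega>: "reference_sequence \<Omega>"
  shows "itlog \<iota> \<Omega> f $ 0 = 0" "itlog \<iota> \<Omega> f $ 1 = 0"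
proof -
  let ?h = "log_compose fps_X"
  have h01: "?h $ 0 = 0" "?h $ 1 = 0"
    using f01 by (simp_all add: log_compose_nth shift_diff_def)
  have unique: "h = ?h" if "h $ 0 = 0" "mat_log \<iota> (iter_mat \<iota> \<Omega> f) = inf_iter_mat \<iota> \<Omega> h" for h
  proof (rule fps_ext)
    fix j
    show "h $ j = ?h $ j"
    proof (cases "j = 0")
      case False
      \<comment> \<open>Row 1 has the entries \<open>h $ j\<close> up to non-zero weights, so the
        matrix determines h.\<close>
      have "inf_iter_mat \<iota> \<Omega> h 1 j = inf_iter_mat \<iota> \<Omega> ?h 1 j"
        using that mat_log_iter_mat[OF \<Omega>] by simp
      then show ?thesis using False \<Omega> by (simp add: inf_iter_mat_def reference_sequence_def)
    qed (use that h01 in simp)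
  qed
  have "itlog \<iota> \<Omega> f = ?h"
    unfolding itlog_def
    by (rule the_equality) (use h01 mat_log_iter_mat[OF \<Omega>] unique in blast)+
  then show "itlog \<iota> \<Omega> f $ 0 = 0" "itlog \<iota> \<Omega> f $ 1 = 0" using h01 by simp_all
qed

end

end

theorem theorem6p2:
  fixes \<iota> :: "rat \<Rightarrow> 'a::idom"
    and \<Omega> :: "nat \<Rightarrow> rat"
    and f :: "'a fps"
  assumes "rat_embedding \<iota>"
    and "reference_sequence \<Omega>"
    and "fps_nth f 0 = 0"
    and "fps_nth f 1 = 1"
  shows "(differentially_algebraic fps_deriv polys_in_fps (itlog \<iota> \<Omega> f) \<longleftrightarrow>
          differentially_algebraic fps_deriv polys_in_poly_fps (frac_iter \<iota> \<Omega> f)) \<and>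
         (differentially_algebraic fps_deriv polys_in_poly_fps (frac_iter \<iota> \<Omega> f) \<longleftrightarrow>
          differentially_algebraic fps_deriv consts_in_poly_fps (frac_iter \<iota> \<Omega> f))"
proof -
  interpret rational_idom \<iota> by standard fact
  define h where "h = itlog \<iota> \<Omega> f"
  have h01: "h $ 0 = 0" "h $ 1 = 0"
    unfolding h_def by (rule itlog_low_coeffs[OF assms(3,4,2)])+
  have flow: "frac_iter \<iota> \<Omega> f = flow h"
    by (rule frac_iter_eq_flow[OF assms(2) h_def[symmetric] h01])
  have "differentially_algebraic fps_deriv polys_in_fps h \<longleftrightarrow>
      differentially_algebraic fps_deriv polys_in_poly_fps (t_const h)"
    unfolding polys_in_poly_fps_eq
    by (rule differentially_algebraic_hom_iff[OF is_inj_hom_t_const, of fps_deriv fps_deriv, OF t_const_deriv, symmetric])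
  also have "\<dots> \<longleftrightarrow> finite_rank ground_consts fps_deriv (flow h)"
    by (simp add: polys_in_poly_fps_finite_rank_iff[OF assms(1)] finite_rank_iterate_iff[OF h01])
  finally show ?thesis
    unfolding flow h_def[symmetric] polys_in_poly_fps_finite_rank_iff[OF assms(1)]
      consts_in_poly_fps_finite_rank_iff[OF assms(1)] by simp
qed

end
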